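(* Let $0<s<\infty$ and let $\mu$ be a finite positive Borel measure on $[0,1)$. Let $1<p<\infty$ and let $X$ be a subspace of $H(\mathbb{D})$ with $\Lambda^p_{1/p}\subseteq X\subseteq\mathcal{B}$. Then $\mu$ is an $s$-Carleson measure on $[0,1)$ if and only if $f_{\mu,s}\in X$, where $$f_{\mu,s}(z)=\sum_{n=0}^\infty\frac{\Gamma(n+s)}{\Gamma(s)\,n!}\,\mu_n z^n,\quad z\in\mathbb{D},\qquad \mu_n=\int_{[0,1)}t^n\,d\mu(t).$$
   Context: Let $\mathbb{D}$ be the open unit disk in $\mathbb{C}$ and let $H(\mathbb{D})$ be the space of analytic functions in $\mathbb{D}$. The Bloch space $\mathcal{B}$ is the set of $f\in H(\mathbb{D})$ with $\sup_{z\in\mathbb{D}}(1-|z|^2)|f'(z)|<\infty$. For $1\le p<\infty$ and $0<r<1$ let $M_p(r,g)=\left(\frac1{2\pi}\int_0^{2\pi}|g(re^{i\theta})|^p\,d\theta\right)^{1/p}$. For $1\le p<\infty$ and $0<\alpha\le1$, the mean Lipschitz space $\Lambda^p_\alpha$ is the set of $f\in H(\mathbb{D})$ having non-tangential limits almost everywhere on the unit circle and such that the integral modulus of continuity of order $p$ of the boundary function $f(e^{i\theta})$ satisfies $\omega_p(t,f)=O(t^\alpha)$ as $t\to0$; by a well-known characterization, $\Lambda^p_\alpha$ consists exactly of those $f\in H(\mathbb{D})$ with $$\sup_{0<r<1}(1-r)^{1-\alpha}M_p(r,f')<\infty.$$ Here $\alpha=1/p$. A positive Borel measure $\mu$ on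 $[0,1)$ is an $s$-Carleson measure if there is a constant $C>0$ such that $\mu([t,1))\le C(1-t)^s$ for all $t\in[0,1)$. *)

theory Defs
  imports
    "HOL-Complex_Analysis.Complex_Analysis"
    "HOL-Library.Function_Algebras"
    "HOL-Library.Landau_Symbols"
begin

(* H(D).  HOL functions are total, so an analytic function in the unit disk is represented
   by its extension by zero.  This makes the representation unique, and the set below is a
   complex vector space under the pointwise operations. *)
definition H_disk :: "(complex \<Rightarrow> complex) set" where
  "H_disk = {f. f holomorphic_on ball 0 1 \<and> (\<forall>z. z \<notin> ball 0 1 \<longrightarrow> f z = 0)}"

(* Provides cfun.subspace: complex linear subspaces for pointwise addition and scaling. *)
global_interpretation cfun: vector_space "\<lambda>(c::complex) (f::complex \<Rightarrow> complex) z. c * f z"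
  by unfold_locales (auto simp: algebra_simps)

definition bloch_space :: "(complex \<Rightarrow> complex) set" where
  "bloch_space =
    {f \<in> H_disk. bdd_above ((\<lambda>z. (1 - (norm z)\<^sup>2) * norm (deriv f z)) ` ball 0 1)}"

definition circle_norm :: "real \<Rightarrow> (real \<Rightarrow> complex) \<Rightarrow> real" where
  "circle_norm p F =
    (1 / (2 * pi) * (LINT \<theta>:{0..2*pi}|lebesgue. norm (F \<theta>) powr p)) powr (1 / p)"

definition integral_mean :: "real \<Rightarrow> real \<Rightarrow> (complex \<Rightarrow> complex) \<Rightarrow> real" where
  "integral_mean p r g = circle_norm p (\<lambda>\<theta>. g (of_real r * cis \<theta>))"

definition hardy_space :: "real \<Rightarrow> (complex \<Rightarrow> complex) set" where
  "hardy_space p = {f \<in> H_disk. bdd_above ((\<lambda>r. integral_mean p r f) ` {0<..<1})}"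

definition stolz_region :: "real \<Rightarrow> complex \<Rightarrow> complex set" where
  "stolz_region \<kappa> \<zeta> = {z \<in> ball 0 1. norm (z - \<zeta>) < \<kappa> * (1 - norm z)}"

definition has_nontangential_limit ::
    "(complex \<Rightarrow> complex) \<Rightarrow> complex \<Rightarrow> complex \<Rightarrow> bool" where
  "has_nontangential_limit f \<zeta> l \<longleftrightarrow>
    (\<forall>\<kappa>>1. (f \<longlongrightarrow> l) (at \<zeta> within stolz_region \<kappa> \<zeta>))"

(* Meaningful only at those boundary points at which the limit exists. *)
definition boundary_value :: "(complex \<Rightarrow> complex) \<Rightarrow> complex \<Rightarrow> complex" where
  "boundary_value f \<zeta> = (THE l. has_nontangential_limit f \<zeta> l)"

definition modulus_of_continuity :: "real \<Rightarrow> real \<Rightarrow> (complex \<Rightarrow> complex) \<Rightarrow> real" where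
  "modulus_of_continuity p t g =
    (SUP h\<in>{0<..t}. circle_norm p (\<lambda>\<theta>. g (cis (\<theta> + h)) - g (cis \<theta>)))"

(* Membership in the Hardy space is the standing convention behind the classical definition
   and is needed for the Hardy-Littlewood characterization
     f in Lambda^p_alpha  iff  M_p(r, f') = O((1-r)^(alpha-1)).
   Without it, (1-z)^4 * exp((1+z)/(1-z)), whose boundary function is C^1 but
   which is not even a Bloch function, would qualify.  It also places the boundary function
   in L^p, so the integrals and the supremum defining the modulus are finite. *)
definition mean_lipschitz :: "real \<Rightarrow> real \<Rightarrow> (complex \<Rightarrow> complex) set" where
  "mean_lipschitz p \<alpha> =
    {f \<in> hardy_space p.
       (AE \<theta> in lebesgue. \<exists>l. has_nontangential_limit f (cis \<theta>) l) \<and>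
       (\<lambda>t. modulus_of_continuity p t (boundary_value f)) \<in> O[at_right 0](\<lambda>t. t powr \<alpha>)}"

definition carleson_measure :: "real \<Rightarrow> real measure \<Rightarrow> bool" where
  "carleson_measure s \<mu> \<longleftrightarrow>
    (\<exists>C>0. \<forall>t\<in>{0..<1}. emeasure \<mu> {t..<1} \<le> ennreal (C * (1 - t) powr s))"

definition moment :: "real measure \<Rightarrow> nat \<Rightarrow> real" where
  "moment \<mu> n = (LINT t|\<mu>. t ^ n)"

definition f_mu :: "real measure \<Rightarrow> real \<Rightarrow> complex \<Rightarrow> complex" where
  "f_mu \<mu> s z =
    (if z \<in> ball 0 1
     then \<Sum>n. of_real (Gamma (real n + s) / (Gamma s * fact n) * moment \<mu> n) * z ^ n
     else 0)"

end

(* With F z = \<integral> (1 - t z)^(-s) d\<mu>(t), the function f_mu is the restriction of F to the disk.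
   If f_mu is Bloch, then f_mu ((1 + r) / 2) - f_mu r is bounded as r tends to 1, and already the
   part of the integral over [r, 1) makes this difference at least a constant times
   (1 - r)^(-s) \<mu>[r, 1).
   Conversely, |1 - t z| \<ge> max (1 - t) (|1 - z| / 2) and the Carleson condition give
   |F'(z)| = O(1 / |1 - z|) up to the boundary.  Hence F is continuous on the closed disk without 1,
   where it yields the boundary function, and it grows at most logarithmically at 1.  A translation
   by h therefore changes F at distance a from 1 by O(h / a) if a is large compared with h, and by
   O((h / a)^(1 / (2 p))) otherwise (after comparison with F (1 - h)); the p-th power of this
   bound is a function of a / h, so that its integral over the circle is O(h). *)

theory Submission
  imports Defs
begin

section \<open>The kernel integral\<close>

text \<open>The measure lives on [0,1) itself: its sigma-algebra is the trace of the Borel sets, so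
  \<open>space \<mu>\<close> is the half-open interval. The exponent \<open>s\<close> is fixed along
  with it because the kernel depends on it.\<close>

locale unit_interval_measure = finite_measure \<mu> for \<mu> :: "real measure" +
  fixes s :: real
  assumes sets_eq: "sets \<mu> = sets (restrict_space borel {0..<1})"
    and s_pos: "0 < s"
begin

lemma space_eq: "space \<mu> = {0..<1}"
  using sets_eq_imp_space_eq[OF sets_eq] by (simp add: space_restrict_space)

lemma borel_measurable_eq: "borel_measurable \<mu> = borel_measurable (restrict_space borel {0..<1})"
  by (rule measurable_cong_sets[OF sets_eq refl])

lemma borel_measurable_lift: "f \<in> borel_measurable borel \<Longrightarrow> f \<in> borel_measurable \<mu>"
  unfolding borel_measurable_eq by (rule measurable_restrict_space1)

text \<open>For t < 1 the base has positive real part, so it avoids the branch cut of the principal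
  power and the kernel is continuous in t.\<close>

lemma borel_measurable_kernel:
  fixes z w :: complex
  assumes "norm z \<le> 1"
  shows "(\<lambda>t. (1 - of_real t * z) powr w) \<in> borel_measurable \<mu>"
proof -
  have Re: "0 < Re (1 - of_real t * z)" if "t \<in> {0..<1}" for t
    using that assms complex_Re_le_cmod[of "of_real t * z"] mult_left_mono[of "norm z" 1 t]
    by (simp add: norm_mult)
  have nz: "1 - of_real t * z \<noteq> 0" if "t \<in> {0..<1}" for t
    using Re[OF that] by (metis less_irrefl zero_complex.sel(1))
  have "continuous_on {0..<1} (\<lambda>t. (1 - of_real t * z) powr w)"
    by (intro continuous_on_powr_complex continuous_intros) (use Re nz less_imp_le in \<open>blast+\<close>)
  then show ?thesis unfolding borel_measurable_eq
    by (rule borel_measurable_continuous_on_restrict)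
qed

end

section \<open>Bounds for the kernel and its binomial series\<close>

text \<open>The point t z differs from z by at most 1 - t, which is itself at most the distance of t
  z from 1; the triangle inequality then loses only a factor 2.\<close>

lemma norm_one_minus_ge:
  fixes z :: complex and t :: real
  assumes "norm z \<le> 1" "0 \<le> t" "t < 1"
  shows "max (1 - t) (norm (1 - z) / 2) \<le> norm (1 - of_real t * z)"
proof -
  have "norm (of_real t * z) \<le> t"
    using assms mult_left_mono[of "norm z" 1 t] by (simp add: norm_mult)
  then have 1: "1 - t \<le> norm (1 - of_real t * z)"
    using norm_triangle_ineq2[of 1 "of_real t * z"] by simp
  have "norm (of_real t * z - z) = (1 - t) * norm z"
  proof -
    have "of_real t * z - z = - (of_real (1 - t) * z)" by (simp add: algebra_simps)
    then have "norm (of_real t * z - z) = norm (of_real (1 - t)::complex) * norm z"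
      by (metis norm_minus_cancel norm_mult)
    moreover have "norm (of_real (1 - t)::complex) = 1 - t"
      unfolding norm_of_real using assms by simp
    ultimately show ?thesis by simp
  qed
  also have "\<dots> \<le> 1 - t" using assms by (simp add: mult_left_le)
  finally have "norm (of_real t * z - z) \<le> norm (1 - of_real t * z)" using 1 by linarith
  moreover have "norm (1 - z) \<le> norm (1 - of_real t * z) + norm (of_real t * z - z)"
    using norm_triangle_ineq[of "1 - of_real t * z" "of_real t * z - z"] by simp
  ultimately show ?thesis using 1 by simp
qed

lemma norm_powr_neg_of_real: "norm (z powr (- of_real a)) = norm z powr (- a)"
  for z :: complex
  using norm_powr_real_powr'[of "- of_real a" z] by simp

text \<open>\<open>d\<close> is any lower bound for the distance to 1, so that one bound serves a
  whole segment. It is used with \<open>q\<close> equal to \<open>s\<close> for the kernel and to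
  \<open>s + 1\<close> for its derivative.\<close>

lemma norm_kernel_le:
  fixes z :: complex and t q d :: real
  assumes "norm z \<le> 1" "0 \<le> t" "t < 1" "0 \<le> q" "d \<le> norm (1 - z)"
  shows "norm ((1 - of_real t * z) powr (- of_real q)) \<le> max (1 - t) (d / 2) powr (- q)"
  unfolding norm_powr_neg_of_real
  using norm_one_minus_ge[of z t] assms by (intro powr_mono2') auto

text \<open>The coefficients are the rising factorials of s divided by n!, that is, the binomial
  coefficients of -s up to sign; the sign is absorbed by expanding at -w.\<close>

lemma binomial_series_sums:
  fixes w :: complex and s :: real
  assumes "0 < s" "norm w < 1"
  shows "(\<lambda>n. of_real (Gamma (real n + s) / (Gamma s * fact n)) * w ^ n) sums (1 - w) powr (- of_real s)"
proof -
  have "((- of_real s) gchoose n) * (- w) ^ n = of_real (Gamma (real n + s) / (Gamma s * fact n)) * w ^ n" for n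
  proof -
    have "pochhammer s n = Gamma (real n + s) / Gamma s"
      using assms pochhammer_Gamma[of s n] nonpos_Ints_nonpos[of s] by (metis add.commute not_le)
    then have p: "pochhammer (of_real s) n = (of_real (Gamma (real n + s) / Gamma s) :: complex)"
      by (metis pochhammer_of_real)
    have "((- of_real s) gchoose n) * (- w) ^ n = ((-1) ^ n * (-1) ^ n) * (pochhammer (of_real s) n / fact n * w ^ n)"
      unfolding gbinomial_pochhammer power_minus[of w n] by simp
    also have "(-1) ^ n * (-1) ^ n = (1::complex)" by (simp flip: power_mult_distrib)
    finally show ?thesis by (simp add: p)
  qed
  then show ?thesis
    using gen_binomial_complex[of "- w" "- of_real s"] assms by simp
qed

text \<open>Serves as the majorant, uniform in t, when the series is integrated term by
  term.\<close>

lemma summable_binomial_series: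
  fixes x s :: real
  assumes "0 < s" "0 \<le> x" "x < 1"
  shows "summable (\<lambda>n. Gamma (real n + s) / (Gamma s * fact n) * x ^ n)"
proof -
  have "summable (\<lambda>n. complex_of_real (Gamma (real n + s) / (Gamma s * fact n) * x ^ n))"
    using sums_summable[OF binomial_series_sums[of s "of_real x"]] assms by simp
  then show ?thesis unfolding summable_complex_of_real .
qed

section \<open>The kernel integral and its power series\<close>

context unit_interval_measure
begin

definition binomial_coefficient :: "nat \<Rightarrow> real" where
  "binomial_coefficient n = Gamma (real n + s) / (Gamma s * fact n)"

lemma binomial_coefficient_nonneg: "0 \<le> binomial_coefficient n"
  using s_pos by (auto simp: binomial_coefficient_def intro!: divide_nonneg_nonneg mult_nonneg_nonneg Gamma_real_nonneg)

text \<open>Kept apart from \<open>f_mu\<close>, which vanishes off the open disk: the integral also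
  converges on the unit circle away from 1 and provides the boundary values there.\<close>

definition kernel_integral :: "complex \<Rightarrow> complex" where
  "kernel_integral z = (LINT t|\<mu>. (1 - of_real t * z) powr (- of_real s))"

text \<open>Away from 1 the kernel is bounded in t, and the measure is finite. At the point 1 the
  kernel is (1 - t)^(-s), whose integral may diverge.\<close>

lemma kernel_integrable:
  fixes z :: complex
  assumes "norm z \<le> 1" "z \<noteq> 1"
  shows "integrable \<mu> (\<lambda>t. (1 - of_real t * z) powr (- of_real s))"
proof (rule integrable_const_bound[OF _ borel_measurable_kernel[OF assms(1)]])
  show "AE t in \<mu>. norm ((1 - of_real t * z) powr (- of_real s)) \<le> (norm (1 - z) / 2) powr (- s)"
  proof (rule AE_I2)
    fix t assume t: "t \<in> space \<mu>"
    have "norm ((1 - of_real t * z) powr (- of_real s)) \<le> max (1 - t) (norm (1 - z) / 2) powr (- s)"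
      using t assms s_pos by (intro norm_kernel_le) (auto simp: space_eq)
    also have "\<dots> \<le> (norm (1 - z) / 2) powr (- s)"
      using assms s_pos by (intro powr_mono2') auto
    finally show "norm ((1 - of_real t * z) powr (- of_real s)) \<le> (norm (1 - z) / 2) powr (- s)" .
  qed
qed

text \<open>Expands the kernel in powers of t z and integrates term by term; since t < 1, a majorant
  in |z| alone justifies the exchange.\<close>

lemma kernel_integral_sums:
  assumes "norm z < 1"
  shows "(\<lambda>n. of_real (binomial_coefficient n * moment \<mu> n) * z ^ n) sums kernel_integral z"
proof -
  let ?g = "\<lambda>n t. of_real (binomial_coefficient n) * (of_real t * z) ^ n :: complex"
  have g: "?g n t = of_real (t ^ n) * (of_real (binomial_coefficient n) * z ^ n)" for n t
    by (simp add: power_mult_distrib)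
  have int: "integrable \<mu> (\<lambda>t. t ^ n)" for n
    using s_pos by (intro integrable_const_bound[where B=1])
      (auto intro!: AE_I2 borel_measurable_lift power_le_one simp: space_eq)
  have bnd: "norm (?g n t) \<le> binomial_coefficient n * norm z ^ n" if "t \<in> {0..<1}" for n t
  proof -
    have "norm (?g n t) = t ^ n * (binomial_coefficient n * norm z ^ n)"
      using that binomial_coefficient_nonneg[of n] unfolding g by (simp add: norm_mult norm_power)
    also have "\<dots> \<le> 1 * (binomial_coefficient n * norm z ^ n)"
      using that binomial_coefficient_nonneg[of n] by (intro mult_right_mono power_le_one) auto
    finally show ?thesis by simp
  qed
  have sm: "summable (\<lambda>n. binomial_coefficient n * norm z ^ n)"
    using summable_binomial_series[OF s_pos _ assms] by (simp add: binomial_coefficient_def)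
  have ig: "integrable \<mu> (?g n)" for n
    unfolding g by (intro integrable_mult_left integrable_of_real int)
  have nb: "(LINT t|\<mu>. norm (?g n t)) \<le> measure \<mu> (space \<mu>) * (binomial_coefficient n * norm z ^ n)" for n
  proof -
    have "(LINT t|\<mu>. norm (?g n t)) \<le> (LINT t|\<mu>. binomial_coefficient n * norm z ^ n)"
      using bnd by (intro integral_mono integrable_norm ig) (auto simp: space_eq)
    then show ?thesis by simp
  qed
  have "(\<lambda>n. LINT t|\<mu>. ?g n t) sums (LINT t|\<mu>. (\<Sum>n. ?g n t))"
  proof (rule sums_integral[OF ig])
    show "AE t in \<mu>. summable (\<lambda>n. norm (?g n t))"
      by (rule AE_I2, rule summable_comparison_test'[OF sm, of 0]) (use bnd in \<open>auto simp: space_eq\<close>)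
    show "summable (\<lambda>n. LINT t|\<mu>. norm (?g n t))"
      by (rule summable_comparison_test'[OF summable_mult[OF sm], of 0 _ "measure \<mu> (space \<mu>)"]) (use nb in \<open>auto simp: integral_nonneg_AE\<close>)
  qed
  also have "(LINT t|\<mu>. (\<Sum>n. ?g n t)) = kernel_integral z"
    unfolding kernel_integral_def
  proof (rule Bochner_Integration.integral_cong[OF refl])
    fix t assume "t \<in> space \<mu>"
    then have "norm (of_real t * z) < 1"
      using assms mult_left_mono[of "norm z" 1 t] by (auto simp: space_eq norm_mult mult_less_le_imp_less)
    from binomial_series_sums[OF s_pos this]
    show "(\<Sum>n. ?g n t) = (1 - of_real t * z) powr (- of_real s)"
      by (simp add: sums_iff binomial_coefficient_def)
  qed
  also have "(\<lambda>n. LINT t|\<mu>. ?g n t) = (\<lambda>n. of_real (binomial_coefficient n * moment \<mu> n) * z ^ n)"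
    unfolding g moment_def by (rule ext) (simp add: integral_mult_left_zero integral_of_real del: of_real_power)
  finally show ?thesis .
qed

lemma f_mu_eq: "norm z < 1 \<Longrightarrow> f_mu \<mu> s z = kernel_integral z"
  using kernel_integral_sums[of z] unfolding f_mu_def by (simp add: sums_iff binomial_coefficient_def)

lemma kernel_integral_holomorphic: "kernel_integral holomorphic_on ball 0 1"
  using kernel_integral_sums by (intro power_series_holomorphic[of 0 1 "\<lambda>n. of_real (binomial_coefficient n * moment \<mu> n)"]) simp

lemma f_mu_holomorphic: "f_mu \<mu> s holomorphic_on ball 0 1"
  using kernel_integral_holomorphic by (rule holomorphic_transform) (simp add: f_mu_eq)


text \<open>On [0,1) the base is positive and the complex power reduces to the real one, so that
  monotonicity of the integrand becomes available.\<close>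

lemma kernel_integral_of_real:
  assumes "0 \<le> x" "x < 1"
  shows "integrable \<mu> (\<lambda>t. (1 - t * x) powr (- s))"
    and "kernel_integral (of_real x) = of_real (LINT t|\<mu>. (1 - t * x) powr (- s))"
proof -
  have eq: "(1 - of_real t * of_real x) powr (- of_real s) = complex_of_real ((1 - t * x) powr (- s))"
    if "t \<in> space \<mu>" for t
  proof -
    have "t * x \<le> 1"
      using that assms mult_le_one[of t x] by (auto simp: space_eq)
    then show ?thesis
      using powr_of_real[of "1 - t * x" "- s"]
      by (simp only: of_real_diff of_real_1 of_real_mult of_real_minus diff_ge_0_iff_ge)
  qed
  have "integrable \<mu> (\<lambda>t. (1 - of_real t * complex_of_real x) powr (- of_real s))
      \<longleftrightarrow> integrable \<mu> (\<lambda>t. complex_of_real ((1 - t * x) powr (- s)))"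
    by (intro Bochner_Integration.integrable_cong refl eq)
  moreover have "integrable \<mu> (\<lambda>t. (1 - of_real t * complex_of_real x) powr (- of_real s))"
    using assms by (intro kernel_integrable) auto
  ultimately have int: "integrable \<mu> (\<lambda>t. complex_of_real ((1 - t * x) powr (- s)))"
    by (rule iffD1)
  then show int': "integrable \<mu> (\<lambda>t. (1 - t * x) powr (- s))"
    by (simp only: complex_of_real_integrable_eq)
  show "kernel_integral (of_real x) = of_real (LINT t|\<mu>. (1 - t * x) powr (- s))"
  proof -
    have "kernel_integral (of_real x) = (LINT t|\<mu>. complex_of_real ((1 - t * x) powr (- s)))"
      unfolding kernel_integral_def by (intro Bochner_Integration.integral_cong refl eq)
    also have "\<dots> = of_real (LINT t|\<mu>. (1 - t * x) powr (- s))" by (rule integral_of_real[OF int'])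
    finally show ?thesis .
  qed
qed

section \<open>From the Bloch condition to the Carleson condition\<close>

text \<open>Mean value theorem between r and the midpoint of r and 1. The derivative in x is s t (1
  - t x)^(-s-1), and at the intermediate point 1 - t \<xi> \<le> 1 - r^2 \<le> 2 (1 - r). The step
  length (1 - r) / 2 turns the exponent -s-1 into -s.\<close>

lemma kernel_difference_ge:
  assumes "0 < r" "r < 1" "r \<le> t" "t < 1"
  shows "s * r / 4 * (2 * (1 - r)) powr (- s) \<le>
    (1 - t * ((1 + r) / 2)) powr (- s) - (1 - t * r) powr (- s)"
proof -
  define r' where "r' = (1 + r) / 2"
  have r': "r < r'" "r' < 1" using assms by (auto simp: r'_def)
  have pos: "0 < 1 - t * x" if "0 \<le> x" "x \<le> r'" for x
  proof -
    have "t * x \<le> 1 * x" using that assms by (intro mult_right_mono) auto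
    then show ?thesis using that r' by simp
  qed
  have "\<exists>\<xi>>r. \<xi> < r' \<and> (1 - t * r') powr (- s) - (1 - t * r) powr (- s)
      = (r' - r) * (s * t * (1 - t * \<xi>) powr (- s - 1))"
  proof (rule MVT2[OF r'(1)])
    fix x assume "r \<le> x" "x \<le> r'"
    then have "0 < 1 - t * x" using pos assms by simp
    then show "((\<lambda>x. (1 - t * x) powr (- s)) has_real_derivative s * t * (1 - t * x) powr (- s - 1)) (at x)"
      by (auto intro!: derivative_eq_intros)
  qed
  then obtain \<xi> where \<xi>: "r < \<xi>" "\<xi> < r'" and eq: "(1 - t * r') powr (- s) - (1 - t * r) powr (- s)
      = (r' - r) * (s * t * (1 - t * \<xi>) powr (- s - 1))" by blast
  have "r * r \<le> t * \<xi>" using assms \<xi> by (intro mult_mono) auto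
  moreover have "1 - r * r \<le> 2 * (1 - r)" using zero_le_square[of "1 - r"] by (simp add: algebra_simps)
  ultimately have "1 - t * \<xi> \<le> 2 * (1 - r)" by linarith
  then have p: "(2 * (1 - r)) powr (- s - 1) \<le> (1 - t * \<xi>) powr (- s - 1)"
    using pos[of \<xi>] \<xi> assms s_pos by (intro powr_mono2') auto
  define P where "P = (2 * (1 - r)) powr (- s - 1)"
  have "(2 * (1 - r)) powr (- s) = P * (2 * (1 - r))"
    using assms powr_add[of "2 * (1 - r)" "- s - 1" 1] by (simp add: P_def)
  then have "s * r / 4 * (2 * (1 - r)) powr (- s) = s * r / 4 * (P * (2 * (1 - r)))"
    by (simp only:)
  also have "\<dots> = (r' - r) * (s * r * P)"
    by (simp add: r'_def field_simps)
  also have "\<dots> \<le> (r' - r) * (s * t * (1 - t * \<xi>) powr (- s - 1))"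
    using assms s_pos r' p by (intro mult_left_mono mult_mono) (auto simp: P_def)
  finally show ?thesis unfolding r'_def[symmetric] eq .
qed

text \<open>The kernel increases along the real axis, so the integrand of the difference is
  nonnegative everywhere; keeping only [r,1), where it has the pointwise lower bound, leaves the
  mass of the tail.\<close>

lemma measure_tail_le_difference:
  assumes "0 < r" "r < 1"
  shows "s * r / 4 * (2 * (1 - r)) powr (- s) * measure \<mu> {r..<1} \<le>
    norm (f_mu \<mu> s (of_real ((1 + r) / 2)) - f_mu \<mu> s (of_real r))"
proof -
  define r' where "r' = (1 + r) / 2"
  have r': "r < r'" "r' < 1" using assms by (auto simp: r'_def)
  define c where "c = s * r / 4 * (2 * (1 - r)) powr (- s)"
  let ?g = "\<lambda>t. (1 - t * r') powr (- s) - (1 - t * r) powr (- s)"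
  have int: "integrable \<mu> (\<lambda>t. (1 - t * r') powr (- s))" "integrable \<mu> (\<lambda>t. (1 - t * r) powr (- s))"
    using assms r' by (auto intro: kernel_integral_of_real)
  have m: "{r..<1} \<in> sets \<mu>"
    unfolding sets_eq sets_restrict_space_iff[of "{0..<1}" borel, simplified]
    using assms by (auto simp: sets_restrict_space intro!: image_eqI[of _ _ "{r..<1}"])
  have "c * measure \<mu> {r..<1} = (LINT t|\<mu>. c * indicator {r..<1} t)"
    using m by simp
  also have "\<dots> \<le> (LINT t|\<mu>. ?g t)"
  proof (rule integral_mono)
    show "integrable \<mu> ?g" using int by auto
    show "integrable \<mu> (\<lambda>t. c * indicator {r..<1} t)"
      using m by (intro integrable_mult_right integrable_real_indicator) (auto simp: emeasure_eq_measure)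
    fix t assume t: "t \<in> space \<mu>"
    show "c * indicator {r..<1} t \<le> ?g t"
    proof (cases "r \<le> t")
      case True
      then show ?thesis
        using kernel_difference_ge[of r t] assms t by (simp add: c_def r'_def space_eq)
    next
      case False
      have "t * r \<le> t * r'" using t r' by (intro mult_left_mono) (auto simp: space_eq)
      moreover have "t * r' < 1"
        using t r' assms mult_le_one[of t r'] mult_strict_mono[of t 1 r' 1] by (auto simp: space_eq)
      ultimately have "(1 - t * r) powr (- s) \<le> (1 - t * r') powr (- s)"
        using s_pos by (intro powr_mono2') auto
      then show ?thesis using False by simp
    qed
  qed
  also have "\<dots> = (LINT t|\<mu>. (1 - t * r') powr (- s)) - (LINT t|\<mu>. (1 - t * r) powr (- s))"
    using int by simp
  also have "\<dots> \<le> norm (complex_of_real \<dots>)" unfolding norm_of_real by (rule abs_ge_self)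
  also have "complex_of_real ((LINT t|\<mu>. (1 - t * r') powr (- s)) - (LINT t|\<mu>. (1 - t * r) powr (- s)))
      = f_mu \<mu> s (of_real r') - f_mu \<mu> s (of_real r)"
    using assms r' by (simp add: f_mu_eq kernel_integral_of_real)
  finally show ?thesis unfolding c_def r'_def .
qed

text \<open>The Bloch bound controls the derivative by 2 M / (1 - r) on the disk of radius (1 + r) /
  2, so the values at r and at that radius differ by at most M, independently of r. Comparison with
  the lower bound through the tail settles r \<ge> 1/2; smaller r are covered by the total
  mass.\<close>

lemma bloch_imp_carleson:
  assumes "f_mu \<mu> s \<in> bloch_space"
  shows "carleson_measure s \<mu>"
proof -
  let ?f = "f_mu \<mu> s"
  obtain M0 where M0: "\<And>z. z \<in> ball 0 1 \<Longrightarrow> (1 - (norm z)\<^sup>2) * norm (deriv ?f z) \<le> M0"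
    using assms unfolding bloch_space_def bdd_above_def by blast
  define M where "M = max M0 1"
  have M: "(1 - (norm z)\<^sup>2) * norm (deriv ?f z) \<le> M" if "norm z < 1" for z
    using M0[of z] that by (simp add: M_def)
  have "0 < M" by (simp add: M_def)
  define V where "V = measure \<mu> (space \<mu>)"
  have "0 \<le> V" by (simp add: V_def)
  \<comment> \<open>The first summand serves r \<ge> 1/2, the second r < 1/2.\<close>
  define C where "C = 8 * M * 2 powr s / s + 2 powr s * V"
  have "0 < C" using \<open>0 < M\<close> \<open>0 \<le> V\<close> s_pos by (simp add: C_def add_pos_nonneg)
  have "measure \<mu> {r..<1} \<le> C * (1 - r) powr s" if r: "r \<in> {0..<1}" for r
  proof (cases "r < 1 / 2")
    case True
    have "measure \<mu> {r..<1} \<le> V * 1" by (simp add: V_def bounded_measure)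
    also have "\<dots> \<le> V * ((2 * (1 - r)) powr s)"
      using True s_pos \<open>0 \<le> V\<close> by (intro mult_left_mono ge_one_powr_ge_zero) auto
    also have "\<dots> = 2 powr s * V * (1 - r) powr s" unfolding powr_mult by (simp only: mult_ac)
    also have "\<dots> \<le> C * (1 - r) powr s"
      using \<open>0 < M\<close> s_pos by (intro mult_right_mono) (auto simp: C_def)
    finally show ?thesis .
  next
    case False
    define r' where "r' = (1 + r) / 2"
    have r': "1/2 \<le> r" "r < r'" "r' < 1" using r False by (auto simp: r'_def)
    have "norm (?f (of_real r') - ?f (of_real r)) \<le> 2 * M / (1 - r) * norm (of_real r' - of_real r :: complex)"
    proof (rule field_differentiable_bound[OF convex_cball[of 0 r']])
      fix z :: complex assume z: "z \<in> cball 0 r'"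
      then have z1: "norm z < 1" using r' by simp
      then show "(?f has_field_derivative deriv ?f z) (at z within cball 0 r')"
        using holomorphic_derivI[OF f_mu_holomorphic open_ball] by (auto intro: has_field_derivative_at_within)
      have "(1 - r) / 2 * norm (deriv ?f z) \<le> (1 - (norm z)\<^sup>2) * norm (deriv ?f z)"
      proof (intro mult_right_mono)
        have "(norm z)\<^sup>2 \<le> norm z * 1" unfolding power2_eq_square using z1 by (intro mult_left_mono) auto
        also have "\<dots> \<le> r'" using z by simp
        finally show "(1 - r) / 2 \<le> 1 - (norm z)\<^sup>2" by (simp add: r'_def field_simps)
      qed auto
      then have "(1 - r) / 2 * norm (deriv ?f z) \<le> M" using M[OF z1] by (rule order_trans)
      then show "norm (deriv ?f z) \<le> 2 * M / (1 - r)"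
        using r by (subst pos_le_divide_eq) (auto simp: mult.commute)
    qed (use r' in auto)
    also have "norm (of_real r' - of_real r :: complex) = (1 - r) / 2"
      unfolding of_real_diff[symmetric] norm_of_real using r' by (simp add: r'_def field_simps)
    also have "2 * M / (1 - r) * ((1 - r) / 2) = M" using r by simp
    finally have "s * r / 4 * (2 * (1 - r)) powr (- s) * measure \<mu> {r..<1} \<le> M"
      using measure_tail_le_difference[of r] r r' unfolding r'_def by simp
    \<comment> \<open>The factor r is replaced by 1/2, so that the final constant is independent of
      r.\<close>
    moreover have "s * (1/2) / 4 * (2 * (1 - r)) powr (- s) * measure \<mu> {r..<1} \<le>
        s * r / 4 * (2 * (1 - r)) powr (- s) * measure \<mu> {r..<1}"
      using r' s_pos by (intro mult_right_mono divide_right_mono mult_left_mono) auto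
    ultimately have le: "s * (1/2) / 4 * (2 * (1 - r)) powr (- s) * measure \<mu> {r..<1} \<le> M"
      by (rule order_trans[rotated])
    define Q where "Q = (2 * (1 - r)) powr s"
    have "0 < Q" using r by (simp add: Q_def)
    then have "measure \<mu> {r..<1} \<le> 8 * M / s * Q"
      using le s_pos unfolding powr_minus Q_def[symmetric] by (simp add: field_simps)
    also have "\<dots> = 8 * M * 2 powr s / s * (1 - r) powr s" unfolding Q_def powr_mult by simp
    also have "\<dots> \<le> C * (1 - r) powr s"
      using \<open>0 \<le> V\<close> by (intro mult_right_mono) (auto simp: C_def)
    finally show ?thesis .
  qed
  then show ?thesis
    unfolding carleson_measure_def emeasure_eq_measure using \<open>0 < C\<close>
    by (intro exI[of _ C]) (auto intro!: ennreal_leI)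
qed

section \<open>Regularity and growth of the kernel integral under the Carleson condition\<close>

text \<open>The set is the tail [1 - x, 1), cut off at 0. For x > 1 the condition at t = 0 still
  suffices, and such scales do occur in the dyadic decomposition.\<close>

lemma carleson_tail:
  assumes K: "\<forall>t\<in>{0..<1}. emeasure \<mu> {t..<1} \<le> ennreal (K * (1 - t) powr s)" and "0 < x" "0 \<le> K"
  shows "emeasure \<mu> {t \<in> space \<mu>. 1 - t \<le> x} \<le> ennreal (K * x powr s)"
proof -
  define y where "y = max 0 (1 - x)"
  have "{t \<in> space \<mu>. 1 - t \<le> x} = {y..<1}" by (auto simp: y_def space_eq)
  then have "emeasure \<mu> {t \<in> space \<mu>. 1 - t \<le> x} \<le> ennreal (K * (1 - y) powr s)"
    using K \<open>0 < x\<close> by (simp add: y_def)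
  also have "\<dots> \<le> ennreal (K * x powr s)"
    using s_pos assms by (intro ennreal_leI mult_left_mono powr_mono2) (auto simp: y_def)
  finally show ?thesis .
qed

text \<open>The integrand is dominated by a sum over the dyadic shells \<open>1 - t \<le> 2 ^ k * d\<close>, on which
  the Carleson condition turns each term into a multiple of \<open>2 ^ (- k) / d\<close>.\<close>

lemma carleson_integral_bound:
  assumes "carleson_measure s \<mu>"
  obtains C where "0 < C" "\<And>d. 0 < d \<Longrightarrow> (LINT t|\<mu>. max (1 - t) d powr (- s - 1)) \<le> C / d"
proof -
  obtain K where "0 < K" and K: "\<forall>t\<in>{0..<1}. emeasure \<mu> {t..<1} \<le> ennreal (K * (1 - t) powr s)"
    using assms unfolding carleson_measure_def by blast
  show ?thesis
  \<comment> \<open>\<open>2 powr (s + 1)\<close> comes from halving the scale in the power -s-1,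
    \<open>K\<close> from the Carleson condition and the last 2 from the geometric series.\<close>
  proof (rule that[of "2 powr (s + 1) * K * 2"])
    fix d :: real assume "0 < d"
    define a where "a k = 2 ^ k * d" for k :: nat
    have a: "0 < a k" for k using \<open>0 < d\<close> by (simp add: a_def)
    let ?A = "\<lambda>k. {t \<in> space \<mu>. 1 - t \<le> a k}"
    let ?h = "\<lambda>k t. ennreal ((a k / 2) powr (- s - 1)) * indicator (?A k) t"
    have A: "?A k \<in> sets \<mu>" for k
      using borel_measurable_lift[of "\<lambda>t. 1 - t"] by (intro borel_measurable_le) auto
    \<comment> \<open>The sets \<open>?A k\<close> are nested; one well-chosen term of the series
      already dominates the integrand at \<open>t\<close>.\<close>
    have "(\<integral>\<^sup>+t. ennreal (max (1 - t) d powr (- s - 1)) \<partial>\<mu>) \<le> (\<integral>\<^sup>+t. (\<Sum>k. ?h k t) \<partial>\<mu>)"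
    proof (rule nn_integral_mono)
      fix t assume t: "t \<in> space \<mu>"
      obtain k0 :: nat where "(1 - t) / d < 2 ^ k0"
        using real_arch_pow[of 2 "(1 - t) / d"] by auto
      then have ex: "1 - t \<le> a k0" using \<open>0 < d\<close> by (simp add: a_def field_simps)
      \<comment> \<open>By minimality the preceding scale \<open>a k / 2\<close> lies below 1 - t;
        for index 0 the value \<open>d\<close> takes over.\<close>
      define k where "k = (LEAST k. 1 - t \<le> a k)"
      have k: "1 - t \<le> a k" unfolding k_def using ex by (rule LeastI)
      have "a k / 2 \<le> max (1 - t) d"
      proof (cases k)
        case 0
        then have "a k / 2 \<le> d" using \<open>0 < d\<close> by (simp add: a_def)
        then show ?thesis by (rule max.coboundedI2)
      next
        case (Suc j)
        then have "\<not> 1 - t \<le> a j"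
          using not_less_Least[of j "\<lambda>k. 1 - t \<le> a k"] by (simp add: k_def)
        then show ?thesis using Suc by (simp add: a_def)
      qed
      then have "max (1 - t) d powr (- s - 1) \<le> (a k / 2) powr (- s - 1)"
        using a[of k] s_pos by (intro powr_mono2') auto
      then have "ennreal (max (1 - t) d powr (- s - 1)) \<le> ?h k t"
        using k t by (simp add: ennreal_leI)
      also have "\<dots> \<le> (\<Sum>k. ?h k t)"
      proof -
        have *: "f k \<le> suminf f" for f :: "nat \<Rightarrow> ennreal"
          using sum_le_suminf[OF summableI, of "{k}" f] by simp
        show ?thesis by (rule *[of "\<lambda>k. ?h k t"])
      qed
      finally show "ennreal (max (1 - t) d powr (- s - 1)) \<le> (\<Sum>k. ?h k t)" .
    qed
    also have "\<dots> = (\<Sum>k. \<integral>\<^sup>+t. ?h k t \<partial>\<mu>)"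
      using A by (intro nn_integral_suminf) auto
    also have "\<dots> = (\<Sum>k. ennreal ((a k / 2) powr (- s - 1)) * emeasure \<mu> (?A k))"
      using A by (simp add: nn_integral_cmult_indicator)
    also have "\<dots> \<le> (\<Sum>k. ennreal (2 powr (s + 1) * K / d * (1 / 2) ^ k))"
    proof (intro suminf_le summableI)
      fix k
      have "ennreal ((a k / 2) powr (- s - 1)) * emeasure \<mu> (?A k)
          \<le> ennreal ((a k / 2) powr (- s - 1)) * ennreal (K * a k powr s)"
        using K a \<open>0 < K\<close> by (intro mult_left_mono carleson_tail) auto
      also have "\<dots> = ennreal ((a k / 2) powr (- s - 1) * (K * a k powr s))"
        by (simp add: ennreal_mult')
      also have "(a k / 2) powr (- s - 1) * (K * a k powr s) = 2 powr (s + 1) * K * (a k powr (- s - 1) * a k powr s)"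
      proof -
        have "2 powr (- s - 1) * 2 powr (s + 1) = (1::real)" by (simp flip: powr_add)
        then show ?thesis using a[of k] by (simp add: powr_divide field_simps)
      qed
      also have "a k powr (- s - 1) * a k powr s = 1 / a k"
        using a[of k] by (simp add: powr_minus_divide flip: powr_add)
      also have "2 powr (s + 1) * K * (1 / a k) = 2 powr (s + 1) * K / d * (1 / 2) ^ k"
        by (simp add: a_def power_divide)
      finally show "ennreal ((a k / 2) powr (- s - 1)) * emeasure \<mu> (?A k) \<le>
        ennreal (2 powr (s + 1) * K / d * (1 / 2) ^ k)" .
    qed
    also have "\<dots> = ennreal (2 powr (s + 1) * K / d * 2)"
      using \<open>0 < K\<close> \<open>0 < d\<close> sums_mult[OF geometric_sums[of "1 / 2 :: real"], of "2 powr (s + 1) * K / d"]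
      by (intro suminf_ennreal_eq) auto
    finally have "(LINT t|\<mu>. max (1 - t) d powr (- s - 1)) \<le> 2 powr (s + 1) * K / d * 2"
      using \<open>0 < K\<close> \<open>0 < d\<close> by (intro integral_real_bounded) auto
    then show "(LINT t|\<mu>. max (1 - t) d powr (- s - 1)) \<le> 2 powr (s + 1) * K * 2 / d"
      by simp
  qed (use \<open>0 < K\<close> in simp)
qed


text \<open>Mean value inequality along the segment. Differentiation raises the order of the
  singularity to s + 1, and the lower bound \<open>d\<close> on the distance to 1 makes the
  derivative bound uniform on the segment.\<close>

lemma kernel_lipschitz:
  fixes z w :: complex
  assumes seg: "closed_segment z w \<subseteq> cball 0 1" and d: "\<And>u. u \<in> closed_segment z w \<Longrightarrow> d \<le> norm (1 - u)"
    and t: "0 \<le> t" "t < 1"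
  shows "norm ((1 - of_real t * z) powr (- of_real s) - (1 - of_real t * w) powr (- of_real s))
    \<le> s * max (1 - t) (d / 2) powr (- s - 1) * norm (z - w)"
proof (rule field_differentiable_bound[OF convex_closed_segment[of z w]])
  fix u assume u: "u \<in> closed_segment z w"
  then have u1: "norm u \<le> 1" using seg by auto
  have "Re (of_real t * u) \<le> t * 1"
    using t u1 complex_Re_le_cmod[of "of_real t * u"] mult_left_mono[of "norm u" 1 t]
    by (simp add: norm_mult)
  then have nn: "1 - of_real t * u \<notin> \<real>\<^sub>\<le>\<^sub>0" using t by (auto simp: complex_nonpos_Reals_iff)
  let ?D = "(- of_real s * (1 - of_real t * u) powr (- of_real s - 1)) * (- of_real t) :: complex"
  have "((\<lambda>u. 1 - of_real t * u) has_field_derivative (- of_real t)) (at u)"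
    by (auto intro!: derivative_eq_intros)
  from DERIV_chain2[OF has_field_derivative_powr[OF nn] this]
  show "((\<lambda>u. (1 - of_real t * u) powr (- of_real s)) has_field_derivative ?D) (at u within closed_segment z w)"
    by (rule has_field_derivative_at_within)
  have "norm ((1 - of_real t * u) powr (- of_real s - 1)) \<le> max (1 - t) (d / 2) powr (- s - 1)"
    using norm_kernel_le[of u t "s + 1" d] t u1 d[OF u] s_pos by simp
  then have "t * norm ((1 - of_real t * u) powr (- of_real s - 1)) \<le> 1 * max (1 - t) (d / 2) powr (- s - 1)"
    using t by (intro mult_mono) auto
  then have "s * (t * norm ((1 - of_real t * u) powr (- of_real s - 1))) \<le> s * (1 * max (1 - t) (d / 2) powr (- s - 1))"
    using s_pos by (intro mult_left_mono) auto
  then show "norm ?D \<le> s * max (1 - t) (d / 2) powr (- s - 1)"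
    using s_pos t by (simp add: norm_mult mult_ac)
qed auto

text \<open>A move by at most half the distance to 1 keeps the whole segment at distance at least |1
  - z| / 2 from 1, so \<open>kernel_lipschitz\<close> can be integrated by means of
  \<open>carleson_integral_bound\<close>. Both points may lie on the circle, which gives control up
  to the boundary.\<close>

lemma kernel_integral_local_lipschitz:
  assumes "carleson_measure s \<mu>"
  obtains C where "0 < C"
    "\<And>z w. \<lbrakk>norm z \<le> 1; norm w \<le> 1; z \<noteq> 1; norm (w - z) \<le> norm (1 - z) / 2\<rbrakk>
      \<Longrightarrow> norm (kernel_integral w - kernel_integral z) \<le> C * norm (w - z) / norm (1 - z)"
proof -
  obtain C where "0 < C" and C: "\<And>d. 0 < d \<Longrightarrow> (LINT t|\<mu>. max (1 - t) d powr (- s - 1)) \<le> C / d"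
    using carleson_integral_bound[OF assms] by blast
  show ?thesis
  \<comment> \<open>\<open>carleson_integral_bound\<close> is used at \<open>d / 2\<close>, a
    quarter of the distance to 1; hence the factor 4.\<close>
  proof (rule that[of "4 * s * C"])
    show "0 < 4 * s * C" using s_pos \<open>0 < C\<close> by simp
    fix z w :: complex
    assume z: "norm z \<le> 1" and w: "norm w \<le> 1" and "z \<noteq> 1" and le: "norm (w - z) \<le> norm (1 - z) / 2"
    define d where "d = norm (1 - z) / 2"
    have "0 < d" using \<open>z \<noteq> 1\<close> by (simp add: d_def)
    have seg: "closed_segment w z \<subseteq> cball 0 1"
      using z w by (intro closed_segment_subset) auto
    have far: "d \<le> norm (1 - u)" if "u \<in> closed_segment w z" for u
    proof -
      have "norm (u - z) \<le> norm (w - z)" using segment_bound(2)[OF that] by (simp add: norm_minus_commute)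
      moreover have "norm (1 - z) \<le> norm (1 - u) + norm (u - z)"
        using norm_triangle_ineq[of "1 - u" "u - z"] by simp
      ultimately show ?thesis using le by (simp add: d_def)
    qed
    have "w \<noteq> 1" using far[of w] \<open>0 < d\<close> by auto
    let ?k = "\<lambda>z t. (1 - of_real t * z) powr (- of_real s) :: complex"
    have int: "integrable \<mu> (?k z)" "integrable \<mu> (?k w)"
      using z w \<open>z \<noteq> 1\<close> \<open>w \<noteq> 1\<close> by (auto intro: kernel_integrable)
    have max_int: "integrable \<mu> (\<lambda>t. max (1 - t) (d / 2) powr (- s - 1))"
    proof (rule integrable_const_bound[where B = "(d / 2) powr (- s - 1)"])
      show "AE t in \<mu>. norm (max (1 - t) (d / 2) powr (- s - 1)) \<le> (d / 2) powr (- s - 1)"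
        using \<open>0 < d\<close> s_pos by (intro AE_I2) (auto intro!: powr_mono2')
    qed (intro borel_measurable_lift, measurable)
    have "norm (kernel_integral w - kernel_integral z) = norm (LINT t|\<mu>. ?k w t - ?k z t)"
      unfolding kernel_integral_def using int by simp
    also have "\<dots> \<le> (LINT t|\<mu>. norm (?k w t - ?k z t))" by (rule integral_norm_bound)
    also have "\<dots> \<le> (LINT t|\<mu>. s * norm (w - z) * max (1 - t) (d / 2) powr (- s - 1))"
    proof (rule integral_mono)
      fix t assume "t \<in> space \<mu>"
      then show "norm (?k w t - ?k z t) \<le> s * norm (w - z) * max (1 - t) (d / 2) powr (- s - 1)"
        using kernel_lipschitz[OF seg far, of t] by (simp add: space_eq mult_ac)
    qed (intro integrable_norm Bochner_Integration.integrable_diff int integrable_mult_right max_int)+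
    also have "\<dots> = s * norm (w - z) * (LINT t|\<mu>. max (1 - t) (d / 2) powr (- s - 1))"
      by simp
    also have "\<dots> \<le> s * norm (w - z) * (C / (d / 2))"
      using C[of "d / 2"] \<open>0 < d\<close> s_pos by (intro mult_left_mono) auto
    also have "\<dots> = 4 * s * C * norm (w - z) / norm (1 - z)" by (simp add: d_def)
    finally show "norm (kernel_integral w - kernel_integral z) \<le> 4 * s * C * norm (w - z) / norm (1 - z)" .
  qed
qed

lemma kernel_integral_continuous:
  assumes "carleson_measure s \<mu>"
  shows "continuous_on (cball 0 1 - {1}) kernel_integral"
proof -
  obtain C where "0 < C" and C: "\<And>z w. \<lbrakk>norm z \<le> 1; norm w \<le> 1; z \<noteq> 1; norm (w - z) \<le> norm (1 - z) / 2\<rbrakk>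
      \<Longrightarrow> norm (kernel_integral w - kernel_integral z) \<le> C * norm (w - z) / norm (1 - z)"
    using kernel_integral_local_lipschitz[OF assms] by blast
  show ?thesis unfolding continuous_on_iff
  proof (intro ballI allI impI)
    fix z e assume z: "z \<in> cball 0 1 - {1 :: complex}" and "0 < (e :: real)"
    define a where "a = norm (1 - z)"
    have "0 < a" using z by (simp add: a_def)
    show "\<exists>d>0. \<forall>w\<in>cball 0 1 - {1}. dist w z < d \<longrightarrow> dist (kernel_integral w) (kernel_integral z) < e"
    proof (intro exI[of _ "min (a / 2) (e * a / C)"] conjI ballI impI)
      show "0 < min (a / 2) (e * a / C)" using \<open>0 < a\<close> \<open>0 < e\<close> \<open>0 < C\<close> by simp
      fix w assume w: "w \<in> cball 0 1 - {1}" "dist w z < min (a / 2) (e * a / C)"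
      then have "norm (kernel_integral w - kernel_integral z) \<le> C * norm (w - z) / a"
        using C[of z w] z by (simp add: a_def dist_norm)
      also have "\<dots> < e" using w \<open>0 < a\<close> \<open>0 < C\<close> by (simp add: dist_norm field_simps)
      finally show "dist (kernel_integral w) (kernel_integral z) < e" by (simp add: dist_norm)
    qed
  qed
qed

text \<open>The local Lipschitz estimate bounds the difference quotients near z, and the bound
  passes to the limit.\<close>

lemma kernel_integral_deriv_bound:
  assumes "carleson_measure s \<mu>"
  obtains C where "0 < C"
    "\<And>z. norm z < 1 \<Longrightarrow> norm (deriv kernel_integral z) \<le> C / norm (1 - z)"
proof -
  obtain C where "0 < C" and C: "\<And>z w. \<lbrakk>norm z \<le> 1; norm w \<le> 1; z \<noteq> 1; norm (w - z) \<le> norm (1 - z) / 2\<rbrakk>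
      \<Longrightarrow> norm (kernel_integral w - kernel_integral z) \<le> C * norm (w - z) / norm (1 - z)"
    using kernel_integral_local_lipschitz[OF assms] by blast
  have "norm (deriv kernel_integral z) \<le> C / norm (1 - z)" if z: "norm z < 1" for z
  proof -
    \<comment> \<open>Within this radius the second point stays in the closed disk and within half
      the distance from z to 1.\<close>
    define r where "r = min (norm (1 - z) / 2) (1 - norm z)"
    have "z \<noteq> 1" using z by auto
    then have "0 < r" using z by (simp add: r_def)
    have "(kernel_integral has_field_derivative deriv kernel_integral z) (at z)"
      using z holomorphic_derivI[OF kernel_integral_holomorphic open_ball] by simp
    then have lim: "((\<lambda>w. (kernel_integral w - kernel_integral z) / (w - z)) \<longlongrightarrow> deriv kernel_integral z) (at z)"
      by (simp add: has_field_derivative_iff)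
    show ?thesis
    proof (rule Lim_norm_ubound[OF _ lim])
      have "norm ((kernel_integral w - kernel_integral z) / (w - z)) \<le> C / norm (1 - z)"
        if w: "w \<noteq> z" "dist w z < r" for w
      proof -
        have "norm w \<le> 1" using w norm_triangle_ineq[of z "w - z"] by (simp add: r_def dist_norm)
        then have "norm (kernel_integral w - kernel_integral z) \<le> C * norm (w - z) / norm (1 - z)"
          using C[of z w] w z \<open>z \<noteq> 1\<close> by (simp add: r_def dist_norm)
        then show ?thesis using w by (simp add: norm_divide field_simps)
      qed
      then show "\<forall>\<^sub>F w in at z. norm ((kernel_integral w - kernel_integral z) / (w - z)) \<le> C / norm (1 - z)"
        unfolding eventually_at using \<open>0 < r\<close> by blast
    qed simp
  qed
  then show ?thesis using that \<open>0 < C\<close> by blast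
qed

text \<open>Logarithmic growth of the integral near \<open>1\<close>, weakened to an arbitrarily small power, with the
  scale-invariant base point \<open>1 - h\<close>.  It comes from integrating the derivative bound along the
  segment from \<open>z\<close> to \<open>1 - h\<close>.\<close>

lemma kernel_integral_near_bound:
  assumes "carleson_measure s \<mu>" and \<beta>: "0 < \<beta>" "\<beta> \<le> 1"
  obtains C where "0 < C"
    "\<And>h z. \<lbrakk>0 < h; h \<le> 1; norm z \<le> 1; z \<noteq> 1; norm (1 - z) \<le> 4 * h\<rbrakk>
      \<Longrightarrow> norm (kernel_integral z - kernel_integral (of_real (1 - h))) \<le> C * (h / norm (1 - z)) powr \<beta>"
proof -
  obtain C where "0 < C" and C: "\<And>z. norm z < 1 \<Longrightarrow> norm (deriv kernel_integral z) \<le> C / norm (1 - z)"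
    using kernel_integral_deriv_bound[OF assms(1)] by blast
  \<comment> \<open>5 bounds the length of the segment in units of \<open>h\<close>, and
    \<open>6 powr \<beta>\<close> comes from the lower bound \<open>a / 6\<close> below.\<close>
  define K where "K = 5 * C * 6 powr \<beta>"
  have "0 < K" using \<open>0 < C\<close> by (simp add: K_def)
  have "norm (kernel_integral z - kernel_integral (of_real (1 - h))) \<le> K / \<beta> * (h / norm (1 - z)) powr \<beta>"
    if h: "0 < h" "h \<le> 1" and z: "norm z \<le> 1" "z \<noteq> 1" and zh: "norm (1 - z) \<le> 4 * h" for h z
  proof -
    define a where "a = norm (1 - z)"
    have "0 < a" using z by (simp add: a_def)
    define \<rho> :: complex where "\<rho> = of_real (1 - h)"
    define u where "u x = z + of_real x * (\<rho> - z)" for x :: real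
    have u0: "u 0 = z" and u1: "u 1 = \<rho>" by (auto simp: u_def)
    have rz: "norm (\<rho> - z) \<le> 5 * h"
    proof -
      have "\<rho> - z = (1 - z) - of_real h" by (simp add: \<rho>_def)
      then have "norm (\<rho> - z) \<le> norm (1 - z) + norm (of_real h :: complex)"
        by (metis norm_triangle_ineq4)
      then show ?thesis using zh h by simp
    qed
    have ux: "norm (u x) \<le> 1 - x * h" if "0 \<le> x" "x \<le> 1" for x
    proof -
      have "u x = of_real (1 - x) * z + of_real (x * (1 - h))" by (simp add: u_def \<rho>_def algebra_simps)
      then have "norm (u x) \<le> norm (of_real (1 - x) * z) + norm (of_real (x * (1 - h)) :: complex)"
        by (metis norm_triangle_ineq)
      also have "\<dots> = (1 - x) * norm z + x * (1 - h)"
        unfolding norm_mult norm_of_real using that h by simp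
      also have "\<dots> \<le> (1 - x) * 1 + x * (1 - h)" using that z by (intro add_mono mult_left_mono) auto
      finally show ?thesis by (simp add: algebra_simps)
    qed
    \<comment> \<open>Two complementary bounds: the segment has depth at least x h in the disk, and
      it cannot come much closer to 1 than its starting point, since |1 - z| \<le> |1 - u x| + 5 x h
      \<le> 6 |1 - u x|.\<close>
    have far: "x * h \<le> norm (1 - u x)" "a / 6 \<le> norm (1 - u x)" if x: "0 \<le> x" "x \<le> 1" for x
    proof -
      show 1: "x * h \<le> norm (1 - u x)"
        using ux[OF x] norm_triangle_ineq2[of 1 "u x"] by simp
      have "norm (1 - z) \<le> norm (1 - u x) + norm (of_real x * (\<rho> - z))"
        using norm_triangle_ineq[of "1 - u x" "of_real x * (\<rho> - z)"] by (simp add: u_def)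
      moreover have "norm (of_real x * (\<rho> - z)) \<le> x * (5 * h)"
        unfolding norm_mult norm_of_real using x rz by (intro mult_mono) auto
      ultimately show "a / 6 \<le> norm (1 - u x)" using 1 by (simp add: a_def)
    qed
    \<comment> \<open>An antiderivative of the derivative bound. It is continuous at 0 although its
      derivative may blow up there; at the starting point, which may lie on the circle, only
      continuity of the integral along the segment is used.\<close>
    let ?\<phi> = "\<lambda>x. K / \<beta> * (h / a) powr \<beta> * x powr \<beta>"
    have "norm (kernel_integral (u 1) - kernel_integral (u 0)) \<le> ?\<phi> 1 - ?\<phi> 0"
    proof (rule differentiable_bound_general[where f = "\<lambda>x. kernel_integral (u x)" and \<phi> = ?\<phi>
          and f' = "\<lambda>x. (\<rho> - z) * deriv kernel_integral (u x)"
          and \<phi>' = "\<lambda>x. K * (h / a) powr \<beta> * x powr (\<beta> - 1)"])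
      have "u ` {0..1} \<subseteq> cball 0 1 - {1}"
      proof (intro image_subsetI)
        fix x :: real assume x: "x \<in> {0..1}"
        then have "norm (u x) \<le> 1" using ux[of x] mult_nonneg_nonneg[of x h] h by (smt (verit) atLeastAtMost_iff)
        moreover have "u x \<noteq> 1" using far(2)[of x] x \<open>0 < a\<close> by auto
        ultimately show "u x \<in> cball 0 1 - {1}" by simp
      qed
      then show "continuous_on {0..1} (\<lambda>x. kernel_integral (u x))"
        by (intro continuous_on_compose2[OF kernel_integral_continuous[OF assms(1)]])
          (auto simp: u_def intro!: continuous_intros)
      show "continuous_on {0..1} ?\<phi>"
        using \<beta> by (intro continuous_intros continuous_on_powr') auto
    next
      fix x :: real assume x: "0 < x" "x < 1"
      have u_lt: "norm (u x) < 1" using ux[of x] x h by (smt (verit) mult_pos_pos)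
      then have "(kernel_integral has_field_derivative deriv kernel_integral (u x)) (at (u x))"
        using holomorphic_derivI[OF kernel_integral_holomorphic open_ball] by simp
      moreover have "(u has_vector_derivative (\<rho> - z)) (at x)"
        unfolding u_def by (auto intro!: derivative_eq_intros)
      ultimately show "((\<lambda>x. kernel_integral (u x)) has_vector_derivative (\<rho> - z) * deriv kernel_integral (u x)) (at x)"
        using field_vector_diff_chain_at[of u "\<rho> - z" x kernel_integral] by (simp add: o_def)
      show "(?\<phi> has_vector_derivative K * (h / a) powr \<beta> * x powr (\<beta> - 1)) (at x)"
        unfolding has_real_derivative_iff_has_vector_derivative[symmetric]
        using x \<beta> by (auto intro!: derivative_eq_intros)
      have "norm ((\<rho> - z) * deriv kernel_integral (u x)) \<le> 5 * h * (C / norm (1 - u x))"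
        unfolding norm_mult using C[OF u_lt] rz h by (intro mult_mono) auto
      also have "\<dots> \<le> 5 * h * (C / ((x * h) powr (1 - \<beta>) * (a / 6) powr \<beta>))"
      proof -
        \<comment> \<open>The weighted geometric mean of the two lower bounds, with weights 1 -
          \<beta> and \<beta>, makes the singularity in \<open>x\<close> integrable.\<close>
        have "(x * h) powr (1 - \<beta>) * (a / 6) powr \<beta> \<le> norm (1 - u x) powr (1 - \<beta>) * norm (1 - u x) powr \<beta>"
          using far[of x] x h \<open>0 < a\<close> \<beta> by (intro mult_mono powr_mono2) auto
        also have "norm (1 - u x) powr (1 - \<beta>) * norm (1 - u x) powr \<beta> = norm (1 - u x)" using far(2)[of x] x \<open>0 < a\<close> by (simp flip: powr_add)
        finally have "(x * h) powr (1 - \<beta>) * (a / 6) powr \<beta> \<le> norm (1 - u x)" .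
        moreover have "u x \<noteq> 1" using far(2)[of x] x \<open>0 < a\<close> by auto
        ultimately show ?thesis using h \<open>0 < C\<close> x \<open>0 < a\<close>
          by (intro mult_left_mono divide_left_mono mult_pos_pos) auto
      qed
      also have "\<dots> = K * (h / a) powr \<beta> * x powr (\<beta> - 1)"
      proof -
        have "x powr (\<beta> - 1) = 1 / x powr (1 - \<beta>)" using powr_minus_divide[of x "1 - \<beta>"] by simp
        moreover have "h powr (1 - \<beta>) = h / h powr \<beta>" using h by (simp add: powr_diff)
        ultimately show ?thesis unfolding K_def powr_mult powr_divide
          using h \<open>0 < a\<close> x by (simp add: field_simps)
      qed
      finally show "norm ((\<rho> - z) * deriv kernel_integral (u x)) \<le> K * (h / a) powr \<beta> * x powr (\<beta> - 1)" .
    qed simp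
    then have "norm (kernel_integral \<rho> - kernel_integral z) \<le> K / \<beta> * (h / a) powr \<beta>"
      using \<beta> by (simp add: u0 u1)
    then show ?thesis by (simp add: norm_minus_commute a_def \<rho>_def)
  qed
  then show ?thesis using that[of "K / \<beta>"] \<open>0 < K\<close> \<beta> by simp
qed

end

section \<open>Integral means over the circle\<close>

lemma norm_one_minus_cis: "norm (1 - cis x) = 2 * \<bar>sin (x / 2)\<bar>"
proof -
  have "(norm (1 - cis x))\<^sup>2 = 2 - 2 * cos x"
    using sin_cos_squared_add[of x] by (simp add: cmod_power2 power2_diff)
  also have "\<dots> = (2 * \<bar>sin (x / 2)\<bar>)\<^sup>2"
    using cos_double_sin[of "x / 2"] by (simp add: power_mult_distrib)
  finally show ?thesis by (rule power2_eq_imp_eq) auto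
qed

text \<open>A crude form of Jordan's inequality. Up to pi/3 the cosine is at least 1/2; beyond it
  sin x \<ge> sqrt 3 / 2 > 4/5 > pi/4 \<ge> x/2.\<close>

lemma sin_ge_half:
  fixes x :: real
  assumes "0 \<le> x" "x \<le> pi / 2"
  shows "x / 2 \<le> sin x"
proof (cases "x \<le> pi / 3")
  case True
  have "sin 0 - 0 / 2 \<le> sin x - x / 2"
  proof (rule DERIV_nonneg_imp_nondecreasing[OF assms(1)])
    fix y assume y: "0 \<le> y" "y \<le> x"
    then have "cos (pi / 3) \<le> cos y" using True by (intro cos_monotone_0_pi_le) auto
    then show "\<exists>D. ((\<lambda>x. sin x - x / 2) has_real_derivative D) (at y) \<and> 0 \<le> D"
      by (intro exI[of _ "cos y - 1 / 2"]) (auto intro!: derivative_eq_intros simp: cos_60)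
  qed
  then show ?thesis by simp
next
  case False
  have "x / 2 \<le> sqrt 3 / 2"
  proof (rule order_trans)
    show "x / 2 \<le> 4 / 5" using assms pi_less_4 pi_approx by simp
    show "4 / 5 \<le> sqrt 3 / 2" using real_le_rsqrt[of "8 / 5" 3] by (simp add: power2_eq_square)
  qed
  also have "\<dots> \<le> sin x" using sin_monotone_2pi_le[of "pi / 3" x] False assms pi_gt_zero by (simp add: sin_60)
  finally show ?thesis .
qed

lemma norm_one_minus_cis_ge:
  assumes "\<bar>x\<bar> \<le> pi"
  shows "\<bar>x\<bar> / 2 \<le> norm (1 - cis x)"
proof -
  have "\<bar>x\<bar> / 2 / 2 \<le> sin (\<bar>x\<bar> / 2)" using assms by (intro sin_ge_half) auto
  also have "\<dots> \<le> \<bar>sin (x / 2)\<bar>" by (cases "0 \<le> x") auto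
  finally show ?thesis by (simp add: norm_one_minus_cis)
qed

lemma norm_one_minus_cis_le: "norm (1 - cis x) \<le> \<bar>x\<bar>"
  using abs_sin_x_le_abs_x[of "x / 2"] by (simp add: norm_one_minus_cis)

lemma norm_cis_add_diff_le: "norm (cis (x + h) - cis x) \<le> \<bar>h\<bar>"
proof -
  have "cis (x + h) - cis x = - (cis x * (1 - cis h))" by (simp add: cis_mult algebra_simps)
  then have "norm (cis (x + h) - cis x) = norm (1 - cis h)" by (simp add: norm_mult)
  then show ?thesis using norm_one_minus_cis_le by simp
qed

text \<open>The exceptional angles form a countable set. Excluding them discards the point 1, where
  the estimates for the kernel integral give nothing.\<close>

lemma AE_cis_add_neq_1: "AE x in lebesgue. cis (x + h) \<noteq> 1"
proof (rule AE_completion, rule AE_mp)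
  let ?N = "range (\<lambda>n::int. real_of_int n * 2 * pi - h)"
  show "AE x in lborel. x \<notin> ?N"
    by (intro AE_not_in countable_imp_null_set_lborel) auto
  have "x \<in> ?N" if "cis (x + h) = 1" for x
  proof -
    have "cos (x + h) = 1" using arg_cong[OF that, of Re] by simp
    then obtain n :: int where "x + h = real_of_int n * 2 * pi" unfolding cos_one_2pi_int by blast
    then have "x = real_of_int n * 2 * pi - h" by simp
    then show ?thesis by blast
  qed
  then show "AE x in lborel. x \<notin> ?N \<longrightarrow> cis (x + h) \<noteq> 1" by auto
qed

section \<open>An integrable weight and majorants on the circle\<close>

text \<open>Near the origin the exponent \<open>1 / 2\<close> keeps the weight integrable, at infinity the exponent \<open>p > 1\<close>.\<close>

definition weight :: "real \<Rightarrow> real \<Rightarrow> real" where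
  "weight p u = (if u < 4 then u powr (- 1 / 2) else u powr (- p))"

lemma weight_nonneg: "0 \<le> weight p u"
  by (simp add: weight_def)

text \<open>At the break point 4 the function can only drop, because -p < -1/2 and the argument
  exceeds 1. Monotonicity allows chords to be replaced by arcs.\<close>

lemma weight_antimono:
  assumes "1 < p" "0 < v" "v \<le> u"
  shows "weight p u \<le> weight p v"
proof (cases "v < 4 \<and> \<not> u < 4")
  case True
  then have "u powr (- p) \<le> u powr (- 1 / 2)" using assms by (intro powr_mono) auto
  also have "\<dots> \<le> v powr (- 1 / 2)" using assms by (intro powr_mono2') auto
  finally show ?thesis using True by (simp add: weight_def)
next
  case False
  then show ?thesis using assms by (auto simp: weight_def intro!: powr_mono2')
qed

text \<open>Passes from explicit gauge integrals to Lebesgue integrability, which nonnegativity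
  permits.\<close>

lemma integrable_lborel_indicator:
  fixes f :: "real \<Rightarrow> real"
  assumes "(f has_integral I) A" "\<And>x. x \<in> A \<Longrightarrow> 0 \<le> f x" "f \<in> borel_measurable borel" "A \<in> sets borel"
  shows "integrable lborel (\<lambda>x. indicator A x * f x)"
proof -
  have "f absolutely_integrable_on A"
    using assms by (intro nonnegative_absolutely_integrable_1) (auto simp: integrable_on_def)
  then have "integrable lebesgue (\<lambda>x. indicator A x * f x)"
    by (simp add: set_integrable_def)
  then show ?thesis using assms by (subst (asm) integrable_completion) auto
qed

lemma integrable_weight:
  assumes "1 < p"
  shows "integrable lborel (\<lambda>x. weight p \<bar>x\<bar>)"
proof -
  \<comment> \<open>A one-sided majorant, zero on negative arguments and with both pieces counted at
    4; together with its reflection it dominates the even function.\<close>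
  define g where "g x = indicator {0..4} x * x powr (- 1 / 2) + indicator {4..} x * x powr (- p)" for x :: real
  have g: "integrable lborel g"
    unfolding g_def using has_integral_powr_from_0[of "- 1 / 2" 4] has_integral_powr_to_inf[of "- p" 4] assms
    by (intro Bochner_Integration.integrable_add integrable_lborel_indicator) auto
  then have "integrable lborel (\<lambda>x. g x + g (- x))"
    using lborel_integrable_real_affine[OF g, of "- 1" 0] by simp
  then show ?thesis
  proof (rule Bochner_Integration.integrable_bound)
    show "(\<lambda>x. weight p \<bar>x\<bar>) \<in> borel_measurable lborel" unfolding weight_def by measurable
    have g0: "0 \<le> g x" for x by (simp add: g_def)
    have "weight p \<bar>x\<bar> \<le> g \<bar>x\<bar>" for x by (auto simp: weight_def g_def)
    moreover have "g \<bar>x\<bar> \<le> g x + g (- x)" for x using g0[of x] g0[of "- x"] by (simp add: abs_if)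
    ultimately show "AE x in lborel. norm (weight p \<bar>x\<bar>) \<le> norm (g x + g (- x))"
      using g0 weight_nonneg by (intro AE_I2) (smt (verit) real_norm_def)
  qed
qed

text \<open>The angles 0 and 2 pi both represent the point 1, and each contributes one bump. The 2
  in \<open>2 * h\<close> is the loss in comparing a chord with its arc.\<close>

definition circle_weight :: "real \<Rightarrow> real \<Rightarrow> real \<Rightarrow> real" where
  "circle_weight p h x = weight p (\<bar>x\<bar> / (2 * h)) + weight p (\<bar>x - 2 * pi\<bar> / (2 * h))"

lemma circle_weight_nonneg: "0 \<le> circle_weight p h x"
  by (simp add: circle_weight_def weight_nonneg)

text \<open>The range extends to 3 pi because a translated angle can leave [0, 2 pi]. Each x in it
  lies within pi of 0 or of 2 pi, where the chord is at least half the arc.\<close>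

lemma weight_le_circle_weight:
  assumes "1 < p" "0 < h" "0 \<le> x" "x \<le> 3 * pi" "cis x \<noteq> 1"
  shows "weight p (norm (1 - cis x) / h) \<le> circle_weight p h x"
proof (cases "x \<le> pi")
  case True
  have "x \<noteq> 0" using assms by auto
  have "weight p (norm (1 - cis x) / h) \<le> weight p (\<bar>x\<bar> / (2 * h))"
    using norm_one_minus_cis_ge[of x] assms True \<open>x \<noteq> 0\<close>
    by (intro weight_antimono) (auto simp: field_simps)
  then show ?thesis using weight_nonneg[of p] by (simp add: circle_weight_def add_increasing2)
next
  case False
  have "x \<noteq> 2 * pi" using assms by auto
  have "cis (x - 2 * pi) = cis x" by (simp flip: cis_divide)
  then have "weight p (norm (1 - cis x) / h) \<le> weight p (\<bar>x - 2 * pi\<bar> / (2 * h))"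
    using norm_one_minus_cis_ge[of "x - 2 * pi"] assms False \<open>x \<noteq> 2 * pi\<close>
    by (intro weight_antimono) (auto simp: field_simps)
  then show ?thesis using weight_nonneg[of p] by (simp add: circle_weight_def add_increasing)
qed

text \<open>By scaling, each of the two bumps contributes 2 h times the integral of the weight. This
  linear dependence on \<open>h\<close> is the source of the exponent 1/p.\<close>

lemma circle_weight_integral:
  assumes "1 < p" "0 < h"
  shows "integrable lborel (\<lambda>x. circle_weight p h (x + c))"
    and "(LINT x|lborel. circle_weight p h (x + c)) = 4 * h * (LINT x|lborel. weight p \<bar>x\<bar>)"
proof -
  have *: "integrable lborel (\<lambda>x. weight p (\<bar>x + a\<bar> / (2 * h)))"
     "(LINT x|lborel. weight p (\<bar>x + a\<bar> / (2 * h))) = 2 * h * (LINT x|lborel. weight p \<bar>x\<bar>)" for a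
  proof -
    have eq: "\<bar>a / (2 * h) + 1 / (2 * h) * x\<bar> = \<bar>x + a\<bar> / (2 * h)" for x
      using assms by (simp add: abs_divide add.commute flip: add_divide_distrib)
    show "integrable lborel (\<lambda>x. weight p (\<bar>x + a\<bar> / (2 * h)))"
      using lborel_integrable_real_affine[OF integrable_weight[OF assms(1)], of "1 / (2 * h)" "a / (2 * h)"] assms
      by (simp only: eq) simp
    show "(LINT x|lborel. weight p (\<bar>x + a\<bar> / (2 * h))) = 2 * h * (LINT x|lborel. weight p \<bar>x\<bar>)"
      using lborel_integral_real_affine[of "1 / (2 * h)" "\<lambda>x. weight p \<bar>x\<bar>" "a / (2 * h)"] assms
      unfolding eq by (simp add: field_simps)
  qed
  show "integrable lborel (\<lambda>x. circle_weight p h (x + c))"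
    unfolding circle_weight_def add_diff_eq[symmetric]
    using *(1)[of c] *(1)[of "c - 2 * pi"] by (simp add: add_diff_eq)
  show "(LINT x|lborel. circle_weight p h (x + c)) = 4 * h * (LINT x|lborel. weight p \<bar>x\<bar>)"
    unfolding circle_weight_def
    using *[of c] *[of "c - 2 * pi"] by (simp add: add_diff_eq)
qed

text \<open>Reduces estimates of the p-norm to pointwise majorants. If the integrand is not
  integrable, its integral is 0 by convention and the bound holds because \<open>w\<close> is
  nonnegative.\<close>

lemma circle_norm_le:
  assumes "integrable lborel w" "\<And>x. 0 \<le> w x" "0 < p"
    and "AE x in lebesgue. x \<in> {0..2 * pi} \<longrightarrow> norm (f x) powr p \<le> w x"
  shows "circle_norm p f \<le> (1 / (2 * pi) * (LINT x|lborel. w x)) powr (1 / p)"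
proof -
  have w: "integrable lebesgue w"
    using assms(1) by (subst integrable_completion) auto
  have "(LINT x:{0..2 * pi}|lebesgue. norm (f x) powr p) \<le> (LINT x|lebesgue. w x)"
    unfolding set_lebesgue_integral_def
  proof (rule integral_mono_AE'[OF w])
    show "AE x in lebesgue. indicator {0..2 * pi} x *\<^sub>R norm (f x) powr p \<le> w x"
      using assms(4) by eventually_elim (use assms(2) in \<open>auto simp: indicator_def\<close>)
  qed (use assms in auto)
  also have "\<dots> = (LINT x|lborel. w x)"
    using assms(1) by (intro integral_completion) auto
  finally have le: "(LINT x:{0..2 * pi}|lebesgue. norm (f x) powr p) \<le> (LINT x|lborel. w x)" .
  have "0 \<le> (LINT x:{0..2 * pi}|lebesgue. norm (f x) powr p)"
    unfolding set_lebesgue_integral_def by (intro integral_nonneg_AE AE_I2) auto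
  then show ?thesis unfolding circle_norm_def
    using le assms(3) by (intro powr_mono2 mult_left_mono) auto
qed

lemma powr_add_le:
  fixes x y p :: real
  assumes "0 \<le> x" "0 \<le> y" "0 < p"
  shows "(x + y) powr p \<le> 2 powr p * (x powr p + y powr p)"
proof -
  have "(x + y) powr p \<le> (2 * max x y) powr p" using assms by (intro powr_mono2) auto
  also have "\<dots> = 2 powr p * max x y powr p" by (simp add: powr_mult)
  also have "\<dots> \<le> 2 powr p * (x powr p + y powr p)" by (intro mult_left_mono) (auto simp: max_def)
  finally show ?thesis .
qed

section \<open>Nontangential limits and boundary values\<close>

text \<open>Radial points satisfy |x - \<zeta>| = 1 - |x| and hence lie in the region of aperture 2,
  arbitrarily close to \<zeta>. This makes nontangential limits unique.\<close>

lemma trivial_limit_stolz: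
  assumes "norm \<zeta> = 1"
  shows "at \<zeta> within stolz_region 2 \<zeta> \<noteq> bot"
proof -
  have "\<zeta> islimpt stolz_region 2 \<zeta>" unfolding islimpt_approachable
  proof (intro allI impI)
    fix e :: real assume "0 < e"
    define r where "r = min (e / 2) (1 / 2)"
    have r: "0 < r" "r < 1" "r < e" using \<open>0 < e\<close> by (auto simp: r_def)
    define x where "x = of_real (1 - r) * \<zeta>"
    have n: "norm x = 1 - r" using assms r unfolding x_def norm_mult norm_of_real by simp
    have "x - \<zeta> = - (of_real r * \<zeta>)" by (simp add: x_def algebra_simps)
    then have d: "norm (x - \<zeta>) = r" using assms r by (simp add: norm_mult)
    then show "\<exists>x\<in>stolz_region 2 \<zeta>. x \<noteq> \<zeta> \<and> dist x \<zeta> < e"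
      using r n by (intro bexI[of _ x]) (auto simp: stolz_region_def dist_norm)
  qed
  then show ?thesis using trivial_limit_within by blast
qed

lemma boundary_value_eq:
  assumes "norm \<zeta> = 1" "has_nontangential_limit f \<zeta> l"
  shows "boundary_value f \<zeta> = l"
  unfolding boundary_value_def
proof (rule the_equality)
  show "has_nontangential_limit f \<zeta> l" by (rule assms(2))
  fix l' assume "has_nontangential_limit f \<zeta> l'"
  then have "(f \<longlongrightarrow> l') (at \<zeta> within stolz_region 2 \<zeta>)" "(f \<longlongrightarrow> l) (at \<zeta> within stolz_region 2 \<zeta>)"
    using assms(2) by (auto simp: has_nontangential_limit_def)
  then show "l' = l" using tendsto_unique[OF trivial_limit_stolz[OF assms(1)]] by blast
qed

section \<open>Membership in the mean Lipschitz space\<close>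

context unit_interval_measure
begin

lemma f_mu_in_H_disk: "f_mu \<mu> s \<in> H_disk"
  unfolding H_disk_def using f_mu_holomorphic by (auto simp: f_mu_def)

text \<open>Continuity of \<open>kernel_integral\<close> up to the circle away from 1 gives the
  limit through all Stolz regions at once.\<close>

lemma f_mu_nontangential_limit:
  assumes "carleson_measure s \<mu>" "norm \<zeta> = 1" "\<zeta> \<noteq> 1"
  shows "has_nontangential_limit (f_mu \<mu> s) \<zeta> (kernel_integral \<zeta>)"
  unfolding has_nontangential_limit_def
proof (intro allI impI)
  fix \<kappa> :: real
  have "(kernel_integral \<longlongrightarrow> kernel_integral \<zeta>) (at \<zeta> within cball 0 1 - {1})"
    using kernel_integral_continuous[OF assms(1)] assms by (simp add: continuous_on_def)
  then have "(kernel_integral \<longlongrightarrow> kernel_integral \<zeta>) (at \<zeta> within stolz_region \<kappa> \<zeta>)"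
    by (rule tendsto_within_subset) (auto simp: stolz_region_def)
  then show "(f_mu \<mu> s \<longlongrightarrow> kernel_integral \<zeta>) (at \<zeta> within stolz_region \<kappa> \<zeta>)"
    by (rule Lim_transform_within[OF _ zero_less_one]) (auto simp: stolz_region_def f_mu_eq)
qed

text \<open>Let a be the distance of z from 1. For a \<ge> 3 h the local Lipschitz estimate gives A
  h / a. For a < 3 h both points lie within 4 h of 1 and are compared with the value at 1 - h; the
  break point 4 of \<open>weight\<close> matches this case.\<close>

lemma kernel_integral_difference_bound:
  assumes "carleson_measure s \<mu>" "1 < p"
  obtains D where "0 < D"
    "\<And>h z w. \<lbrakk>0 < h; h \<le> 1; norm z \<le> 1; norm w \<le> 1; z \<noteq> 1; w \<noteq> 1; norm (w - z) \<le> h\<rbrakk>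
      \<Longrightarrow> norm (kernel_integral w - kernel_integral z) powr p
        \<le> D * (weight p (norm (1 - z) / h) + weight p (norm (1 - w) / h))"
proof -
  obtain A where "0 < A" and A: "\<And>z w. \<lbrakk>norm z \<le> 1; norm w \<le> 1; z \<noteq> 1; norm (w - z) \<le> norm (1 - z) / 2\<rbrakk>
      \<Longrightarrow> norm (kernel_integral w - kernel_integral z) \<le> A * norm (w - z) / norm (1 - z)"
    using kernel_integral_local_lipschitz[OF assms(1)] by blast
  \<comment> \<open>Chosen so that the p-th power of the growth bound has exponent 1/2, which is
    integrable at 0.\<close>
  define \<beta> where "\<beta> = 1 / (2 * p)"
  have \<beta>: "0 < \<beta>" "\<beta> \<le> 1" "\<beta> * p = 1 / 2" using assms by (auto simp: \<beta>_def field_simps)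
  obtain B where "0 < B" and B: "\<And>h z. \<lbrakk>0 < h; h \<le> 1; norm z \<le> 1; z \<noteq> 1; norm (1 - z) \<le> 4 * h\<rbrakk>
      \<Longrightarrow> norm (kernel_integral z - kernel_integral (of_real (1 - h))) \<le> B * (h / norm (1 - z)) powr \<beta>"
    using kernel_integral_near_bound[OF assms(1) \<beta>(1,2)] by blast
  show ?thesis
  proof (rule that[of "A powr p + 2 powr p * B powr p"])
    show "0 < A powr p + 2 powr p * B powr p" using \<open>0 < A\<close> by (simp add: add_pos_nonneg)
    fix h :: real and z w :: complex
    assume h: "0 < h" "h \<le> 1" and z: "norm z \<le> 1" "z \<noteq> 1" and w: "norm w \<le> 1" "w \<noteq> 1"
      and zw: "norm (w - z) \<le> h"
    define a b where "a = norm (1 - z)" and "b = norm (1 - w)"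
    have ab: "0 < a" "0 < b" using z w by (auto simp: a_def b_def)
    define W where "W = weight p (a / h) + weight p (b / h)"
    have "0 \<le> W" by (simp add: W_def weight_nonneg)
    let ?d = "norm (kernel_integral w - kernel_integral z)"
    have "?d powr p \<le> (A powr p + 2 powr p * B powr p) * W"
    proof (cases "3 * h \<le> a")
      case True
      have "?d \<le> A * norm (w - z) / a" using A[of z w] z w zw True h by (simp add: a_def)
      also have "\<dots> \<le> A * h / a" using zw \<open>0 < A\<close> ab by (intro divide_right_mono mult_left_mono) auto
      finally have "?d powr p \<le> (A * (h / a)) powr p" using assms by (intro powr_mono2) auto
      also have "\<dots> = A powr p * (a / h) powr (- p)"
        by (simp add: powr_mult powr_divide powr_minus field_simps)
      also have "\<dots> \<le> A powr p * weight p (a / h)"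
      proof -
        \<comment> \<open>For 3 \<le> a / h < 4 the weight is still the power -1/2, which dominates
          because the base is at least 1.\<close>
        have "1 \<le> a / h" using True h by simp
        then have "(a / h) powr (- p) \<le> (a / h) powr (- 1 / 2)" using assms by (intro powr_mono) auto
        then show ?thesis by (intro mult_left_mono) (auto simp: weight_def)
      qed
      also have "\<dots> \<le> A powr p * W" by (intro mult_left_mono) (auto simp: W_def weight_nonneg)
      also have "\<dots> \<le> (A powr p + 2 powr p * B powr p) * W" using \<open>0 \<le> W\<close> by (intro mult_right_mono) auto
      finally show ?thesis .
    next
      case False
      have "b \<le> a + norm (w - z)" unfolding a_def b_def
        using norm_triangle_ineq[of "1 - z" "z - w"] by (simp add: norm_minus_commute)
      then have b4: "b < 4 * h" using False zw by simp
      define c :: complex where "c = of_real (1 - h)"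
      have wt: "(B * (h / x) powr \<beta>) powr p = B powr p * weight p (x / h)" if "0 < x" "x < 4 * h" for x
      proof -
        have "(B * (h / x) powr \<beta>) powr p = B powr p * (h / x) powr (1 / 2)"
          by (simp add: powr_mult powr_powr \<beta>)
        also have "(h / x) powr (1 / 2) = (x / h) powr (- 1 / 2)"
          by (simp add: powr_divide powr_minus field_simps)
        also have "\<dots> = weight p (x / h)" using that h by (simp add: weight_def field_simps)
        finally show ?thesis .
      qed
      have "?d \<le> norm (kernel_integral w - kernel_integral c) + norm (kernel_integral z - kernel_integral c)"
        using norm_triangle_ineq4[of "kernel_integral w - kernel_integral c" "kernel_integral z - kernel_integral c"] by simp
      also have "\<dots> \<le> B * (h / b) powr \<beta> + B * (h / a) powr \<beta>"
        unfolding c_def a_def b_def using h z w b4 False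
        by (intro add_mono B) (auto simp: a_def b_def)
      finally have "?d powr p \<le> (B * (h / b) powr \<beta> + B * (h / a) powr \<beta>) powr p"
        using assms by (intro powr_mono2) auto
      also have "\<dots> \<le> 2 powr p * ((B * (h / b) powr \<beta>) powr p + (B * (h / a) powr \<beta>) powr p)"
        using \<open>0 < B\<close> assms by (intro powr_add_le) auto
      also have "\<dots> = 2 powr p * B powr p * W"
        using ab b4 False by (simp add: wt W_def algebra_simps)
      also have "\<dots> \<le> (A powr p + 2 powr p * B powr p) * W" using \<open>0 \<le> W\<close> by (intro mult_right_mono) auto
      finally show ?thesis .
    qed
    then show "?d powr p \<le> (A powr p + 2 powr p * B powr p)
        * (weight p (norm (1 - z) / h) + weight p (norm (1 - w) / h))"
      by (simp add: W_def a_def b_def)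
  qed
qed

text \<open>At scale h = 1 the growth bound has base point 0 and covers the whole disk. Its p-th
  power has an integrable majorant on the circle that does not depend on the radius.\<close>

lemma f_mu_in_hardy_space:
  assumes "carleson_measure s \<mu>" "1 < p"
  shows "f_mu \<mu> s \<in> hardy_space p"
proof -
  define \<beta> where "\<beta> = 1 / (2 * p)"
  have \<beta>: "0 < \<beta>" "\<beta> \<le> 1" "\<beta> * p = 1 / 2" using assms by (auto simp: \<beta>_def field_simps)
  obtain B where "0 < B" and B: "\<And>h z. \<lbrakk>0 < h; h \<le> 1; norm z \<le> 1; z \<noteq> 1; norm (1 - z) \<le> 4 * h\<rbrakk>
      \<Longrightarrow> norm (kernel_integral z - kernel_integral (of_real (1 - h))) \<le> B * (h / norm (1 - z)) powr \<beta>"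
    using kernel_integral_near_bound[OF assms(1) \<beta>(1,2)] by blast
  define k0 where "k0 = norm (kernel_integral 0)"
  \<comment> \<open>The scale 2 in \<open>circle_weight\<close> absorbs the factor lost in |1 - r
    cis x| \<ge> |1 - cis x| / 2.\<close>
  define w where "w x = 2 powr p * k0 powr p * indicator {0..2 * pi} x + 2 powr p * B powr p * circle_weight p 2 x" for x
  have w: "integrable lborel w"
    unfolding w_def using circle_weight_integral(1)[OF assms(2), of 2 0]
    by (intro Bochner_Integration.integrable_add integrable_mult_right integrable_real_indicator) auto
  have w0: "0 \<le> w x" for x using circle_weight_nonneg by (auto simp: w_def)
  have bound: "integral_mean p r (f_mu \<mu> s) \<le> (1 / (2 * pi) * (LINT x|lborel. w x)) powr (1 / p)"
    if r: "r \<in> {0<..<1}" for r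
    unfolding integral_mean_def
  proof (rule circle_norm_le[OF w w0])
    show "AE x in lebesgue. x \<in> {0..2 * pi} \<longrightarrow> norm (f_mu \<mu> s (of_real r * cis x)) powr p \<le> w x"
      using AE_cis_add_neq_1[of 0]
    proof eventually_elim
      case (elim x)
      show ?case
      proof
        assume x: "x \<in> {0..2 * pi}"
        define z where "z = of_real r * cis x"
        have z: "norm z < 1" using r by (simp add: z_def norm_mult)
        then have "z \<noteq> 1" by auto
        have "norm (1 - z) \<le> 2" using norm_triangle_ineq4[of 1 z] z by simp
        then have 4: "norm (1 - z) < 4" by simp
        have half: "norm (1 - cis x) / 2 \<le> norm (1 - z)"
          using norm_one_minus_ge[of "cis x" r] r by (simp add: z_def)
        have "norm (kernel_integral z) \<le> k0 + norm (kernel_integral z - kernel_integral 0)"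
          unfolding k0_def using norm_triangle_ineq[of "kernel_integral 0" "kernel_integral z - kernel_integral 0"] by simp
        also have "\<dots> \<le> k0 + B * (1 / norm (1 - z)) powr \<beta>"
          using B[of 1 z] z 4 \<open>z \<noteq> 1\<close> by simp
        finally have "norm (f_mu \<mu> s z) \<le> k0 + B * (1 / norm (1 - z)) powr \<beta>"
          by (simp add: f_mu_eq z)
        then have "norm (f_mu \<mu> s z) powr p \<le> (k0 + B * (1 / norm (1 - z)) powr \<beta>) powr p"
          using assms by (intro powr_mono2) auto
        also have "\<dots> \<le> 2 powr p * (k0 powr p + (B * (1 / norm (1 - z)) powr \<beta>) powr p)"
          using \<open>0 < B\<close> assms by (intro powr_add_le) (auto simp: k0_def)
        also have "(B * (1 / norm (1 - z)) powr \<beta>) powr p = B powr p * weight p (norm (1 - z))"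
          using 4 by (simp add: powr_mult powr_powr \<beta> weight_def powr_divide powr_minus field_simps)
        also have "weight p (norm (1 - z)) \<le> weight p (norm (1 - cis x) / 2)"
          using half elim assms by (intro weight_antimono) auto
        also have "\<dots> \<le> circle_weight p 2 x"
          using x elim assms by (intro weight_le_circle_weight) auto
        finally have "norm (f_mu \<mu> s z) powr p \<le> 2 powr p * (k0 powr p + B powr p * circle_weight p 2 x)"
          by (simp add: mult_left_mono)
        also have "\<dots> = w x" using x by (simp add: w_def algebra_simps)
        finally show "norm (f_mu \<mu> s (of_real r * cis x)) powr p \<le> w x" by (simp add: z_def)
      qed
    qed
  qed (use assms in simp)
  then show ?thesis
    unfolding hardy_space_def by (intro CollectI conjI f_mu_in_H_disk bdd_aboveI2) (rule bound)
qed

text \<open>The p-th power of a translation difference is dominated by the weights at the two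
  angles, whose integrals are linear in \<open>h\<close>; the p-th root yields the exponent
  1/p.\<close>

lemma f_mu_modulus_of_continuity:
  assumes "carleson_measure s \<mu>" "1 < p"
  obtains E where "0 \<le> E"
    "\<And>t. \<lbrakk>0 < t; t \<le> 1\<rbrakk> \<Longrightarrow> \<bar>modulus_of_continuity p t (boundary_value (f_mu \<mu> s))\<bar> \<le> E * t powr (1 / p)"
proof -
  obtain D where "0 < D" and D: "\<And>h z w. \<lbrakk>0 < h; h \<le> 1; norm z \<le> 1; norm w \<le> 1; z \<noteq> 1; w \<noteq> 1; norm (w - z) \<le> h\<rbrakk>
      \<Longrightarrow> norm (kernel_integral w - kernel_integral z) powr p
        \<le> D * (weight p (norm (1 - z) / h) + weight p (norm (1 - w) / h))"
    using kernel_integral_difference_bound[OF assms] by blast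
  define I where "I = (LINT x|lborel. weight p \<bar>x\<bar>)"
  have "0 \<le> I" unfolding I_def by (intro integral_nonneg_AE AE_I2 weight_nonneg)
  \<comment> \<open>The factor 8 collects the two circle weights, each of integral 4 h I.\<close>
  define E where "E = (1 / (2 * pi) * (D * (8 * I))) powr (1 / p)"
  let ?g = "boundary_value (f_mu \<mu> s)"
  let ?N = "\<lambda>h. circle_norm p (\<lambda>\<theta>. ?g (cis (\<theta> + h)) - ?g (cis \<theta>))"
  have bv: "?g (cis x) = kernel_integral (cis x)" if "cis x \<noteq> 1" for x
    using that by (intro boundary_value_eq f_mu_nontangential_limit assms) auto
  have N: "?N h \<le> E * h powr (1 / p)" if h: "0 < h" "h \<le> 1" for h
  proof -
    define w where "w x = D * (circle_weight p h (x + 0) + circle_weight p h (x + h))" for x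
    have w: "integrable lborel w" unfolding w_def
      by (intro integrable_mult_right Bochner_Integration.integrable_add circle_weight_integral assms h)
    have "?N h \<le> (1 / (2 * pi) * (LINT x|lborel. w x)) powr (1 / p)"
    proof (rule circle_norm_le[OF w])
      show "0 \<le> w x" for x using \<open>0 < D\<close> by (simp add: w_def circle_weight_nonneg)
      show "AE x in lebesgue. x \<in> {0..2 * pi} \<longrightarrow> norm (?g (cis (x + h)) - ?g (cis x)) powr p \<le> w x"
        using AE_cis_add_neq_1[of 0] AE_cis_add_neq_1[of h]
      proof eventually_elim
        case (elim x)
        show ?case
        proof
          assume x: "x \<in> {0..2 * pi}"
          have "norm (?g (cis (x + h)) - ?g (cis x)) powr p
              \<le> D * (weight p (norm (1 - cis x) / h) + weight p (norm (1 - cis (x + h)) / h))"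
            using D[of h "cis x" "cis (x + h)"] norm_cis_add_diff_le[of x h] h elim by (simp add: bv)
          \<comment> \<open>The translated angle is at most 2 pi + 1 < 3 pi.\<close>
          also have "\<dots> \<le> w x" unfolding w_def
            using x h elim assms(2) \<open>0 < D\<close> pi_gt3
            by (intro mult_left_mono add_mono weight_le_circle_weight) (auto intro: weight_le_circle_weight)
          finally show "norm (?g (cis (x + h)) - ?g (cis x)) powr p \<le> w x" .
        qed
      qed
    qed (use assms in simp)
    also have "(LINT x|lborel. w x) = D * (8 * I) * h"
      unfolding w_def integral_mult_right_zero
        Bochner_Integration.integral_add[OF circle_weight_integral(1,1)[OF assms(2) h(1)]]
        circle_weight_integral(2)[OF assms(2) h(1)]
      by (simp add: I_def)
    also have "(1 / (2 * pi) * (D * (8 * I) * h)) powr (1 / p) = E * h powr (1 / p)"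
      by (simp add: E_def powr_mult powr_divide)
    finally show ?thesis .
  qed
  have "\<bar>modulus_of_continuity p t ?g\<bar> \<le> E * t powr (1 / p)" if t: "0 < t" "t \<le> 1" for t
  proof -
    have Nt: "?N h \<le> E * t powr (1 / p)" if "h \<in> {0<..t}" for h
    proof -
      have "?N h \<le> E * h powr (1 / p)" using that t by (intro N) auto
      also have "\<dots> \<le> E * t powr (1 / p)"
        using that assms by (intro mult_left_mono powr_mono2) (auto simp: E_def)
      finally show ?thesis .
    qed
    have "modulus_of_continuity p t ?g \<le> E * t powr (1 / p)"
      unfolding modulus_of_continuity_def using t Nt by (intro cSUP_least) auto
    \<comment> \<open>The absolute value also requires a lower bound: the family is bounded above by
      \<open>Nt\<close>, so the supremum is at least its nonnegative member at h = t.\<close>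
    moreover have "0 \<le> modulus_of_continuity p t ?g"
    proof -
      have "0 \<le> ?N t" by (simp add: circle_norm_def)
      also have "\<dots> \<le> modulus_of_continuity p t ?g"
        unfolding modulus_of_continuity_def using t Nt by (intro cSUP_upper bdd_aboveI2) auto
      finally show ?thesis .
    qed
    ultimately show ?thesis by simp
  qed
  then show ?thesis using that[of E] by (simp add: E_def)
qed

lemma carleson_imp_mean_lipschitz:
  assumes "carleson_measure s \<mu>" "1 < p"
  shows "f_mu \<mu> s \<in> mean_lipschitz p (1 / p)"
proof -
  obtain E where "0 \<le> E" and E: "\<And>t. \<lbrakk>0 < t; t \<le> 1\<rbrakk>
      \<Longrightarrow> \<bar>modulus_of_continuity p t (boundary_value (f_mu \<mu> s))\<bar> \<le> E * t powr (1 / p)"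
    using f_mu_modulus_of_continuity[OF assms] by blast
  have "AE \<theta> in lebesgue. \<exists>l. has_nontangential_limit (f_mu \<mu> s) (cis \<theta>) l"
    using AE_cis_add_neq_1[of 0]
    by eventually_elim (use f_mu_nontangential_limit[OF assms(1)] in \<open>force simp: norm_cis\<close>)
  moreover have "(\<lambda>t. modulus_of_continuity p t (boundary_value (f_mu \<mu> s))) \<in> O[at_right 0](\<lambda>t. t powr (1 / p))"
  proof (rule bigoI)
    show "\<forall>\<^sub>F t in at_right 0. norm (modulus_of_continuity p t (boundary_value (f_mu \<mu> s))) \<le> E * norm (t powr (1 / p))"
      unfolding eventually_at_right_field using E by (intro exI[of _ 1]) auto
  qed
  ultimately show ?thesis
    unfolding mean_lipschitz_def using f_mu_in_hardy_space[OF assms] by blast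
qed

end

theorem proposition2p2:
  fixes s p :: real and \<mu> :: "real measure" and X :: "(complex \<Rightarrow> complex) set"
  assumes "0 < s"
    and "finite_measure \<mu>"
    and "sets \<mu> = sets (restrict_space borel {0..<1})"
    and "1 < p"
    and "X \<subseteq> H_disk"
    and "cfun.subspace X"
    and "mean_lipschitz p (1 / p) \<subseteq> X"
    and "X \<subseteq> bloch_space"
  shows "carleson_measure s \<mu> \<longleftrightarrow> f_mu \<mu> s \<in> X"
proof -
  interpret unit_interval_measure \<mu> s
    using assms by (simp add: unit_interval_measure_def unit_interval_measure_axioms_def)
  show ?thesis
    using carleson_imp_mean_lipschitz[of p] bloch_imp_carleson assms by blast
qed

end
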